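(* Let $X$ be a d-space, $X_1,X_2\subseteq X$ with $X=\mathrm{Int}(X_1)\cup\mathrm{Int}(X_2)$, the dipaths of $X$ being the finite concatenations of dipaths of $X_1$ and $X_2$, and $X_0=X_1\cap X_2$. For $k=0,1,2$ let $X_k=X_{k,0}\supseteq X_{k,1}\supseteq\dots\supseteq X_{k,n}$ with functors $P_{k,\ell}:\vec\pi_1(X_k,X_{k,\ell-1})\to\vec\pi_1(X_k,X_{k,\ell})$ ($1\le\ell\le n$) be compatible chains of future retracts and past retracts. Put $X_\ell:=X_{1,\ell}\cup X_{2,\ell}$ (so $X_0$-level is $X$). Then for each $\ell$ the square formed by $\vec\pi_1(X_0,X_{0,\ell})$, $\vec\pi_1(X_1,X_{1,\ell})$, $\vec\pi_1(X_2,X_{2,\ell})$, $\vec\pi_1(X,X_\ell)$ and the inclusion-induced functors is a pushout of categories; there is a unique functor $P_\ell:\vec\pi_1(X,X_{\ell-1})\to\vec\pi_1(X,X_\ell)$ with $P_\ell\circ j_{k,\ell-1}=j_{k,\ell}\circ P_{k,\ell}$ for $k=1,2$ (where $j_{k,m}:\vec\pi_1(X_k,X_{k,m})\to\vec\pi_1(X,X_m)$ is induced by inclusion); and $P_\ell$ is a future retract if the $P_{k,\ell}$ are future retracts and a past retract if they are past retracts. Hence the pushout $\vec\pi_1(X)\xrightarrow{P_1}\vec\pi_1(X,X_1)\xrightarrow{P_2}\dots\xrightarrow{P_n}\vec\pi_1(X,X_n)$ is a chain of future retracts and past retracts.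
   Context: A d-space is a topological space with a set of continuous paths $[0,1]\to X$ (dipaths) containing all constant paths, closed under precomposition with continuous non-decreasing maps $[0,1]\to[0,1]$ and under concatenation; subsets carry the dipaths with image in them. The fundamental category $\vec\pi_1(X)$ has objects the points of $X$ and morphisms $a\to b$ the classes of dipaths from $a$ to $b$ modulo the equivalence relation generated by endpoint-fixing directed homotopies; composition is concatenation. For $A\subseteq X$, $\vec\pi_1(X,A)$ is the full subcategory on objects in $A$; inclusions induce functors. For $A\subseteq B\subseteq X$ with inclusion $\iota:\vec\pi_1(X,A)\to\vec\pi_1(X,B)$, a future retract is a functor $P:\vec\pi_1(X,B)\to\vec\pi_1(X,A)$ left adjoint to $\iota$ whose unit satisfies $\eta_a=\mathrm{id}_a$ for $a\in A$; a past retract is a functor $P$ right adjoint to $\iota$ whose counit satisfies $\varepsilon_a=\mathrm{id}_a$ for $a\in A$. Compatible chains: for each $\ell\in\{1,\dots,n\}$ the three functors $P_{0,\ell},P_{1,\ell},P_{2,\ell}$ are either all future retracts or all past retracts; $X_{0,\ell}=X_{1,\ell}\cap X_{2,\ell}$; $X_\ell=X_{1,\ell}\cup X_{2,\ell}$ satisfies $X_\ell=\mathrm{Int}_{X_\ell}(X_{1,\ell})\cup\mathrm{Int}_{X_\ell}(X_{2,\ell})$; with $i_{k,m}:\vec\pi_1(X_0,X_{0,m})\to\vec\pi_1(X_k,X_{k,m})$ the inclusion-induced functors ($k=1,2$), one has $P_{k,\ell}\circ i_{k,\ell-1}=i_{k,\ell}\circ P_{0,\ell}$; and for every $x\in X_{0,\ell-1}$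 the unit (resp. counit) of $P_{0,\ell}$ at $x$ maps to the unit (resp. counit) of $P_{k,\ell}$ at $x$ under the functor $\vec\pi_1(X_0)\to\vec\pi_1(X_k)$, $k=1,2$. *)

theory Defs
  imports "HOL-Analysis.Analysis"
begin

text \<open>A d-space is a subset X of a topological space (with the subspace topology)
  together with a set D of dipaths, paths being maps real => 'a continuous on [0,1].\<close>

definition d_space :: "'a::topological_space set \<Rightarrow> (real \<Rightarrow> 'a) set \<Rightarrow> bool" where
  "d_space X D \<longleftrightarrow>
     (\<forall>p\<in>D. continuous_on {0..1} p \<and> p ` {0..1} \<subseteq> X) \<and>
     (\<forall>x\<in>X. (\<lambda>t. x) \<in> D) \<and>
     (\<forall>p\<in>D. \<forall>\<phi>. continuous_on {0..1} \<phi> \<and> \<phi> ` {0..1} \<subseteq> {0..1} \<and> mono_on {0..1} \<phi>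
                 \<longrightarrow> p \<circ> \<phi> \<in> D) \<and>
     (\<forall>p\<in>D. \<forall>q\<in>D. p 1 = q 0 \<longrightarrow> p +++ q \<in> D)"

definition dsub :: "(real \<Rightarrow> 'a) set \<Rightarrow> 'a set \<Rightarrow> (real \<Rightarrow> 'a) set" where
  "dsub D Y = {p \<in> D. p ` {0..1} \<subseteq> Y}"

definition sq_dipath :: "(real \<Rightarrow> real \<times> real) \<Rightarrow> bool" where
  "sq_dipath \<gamma> \<longleftrightarrow> continuous_on {0..1} \<gamma> \<and> \<gamma> ` {0..1} \<subseteq> {0..1} \<times> {0..1} \<and>
     mono_on {0..1} (fst \<circ> \<gamma>) \<and> mono_on {0..1} (snd \<circ> \<gamma>)"

definition dihtpy :: "'a::topological_space set \<Rightarrow> (real \<Rightarrow> 'a) set \<Rightarrow> (real \<Rightarrow> 'a) \<Rightarrow> (real \<Rightarrow> 'a) \<Rightarrow> bool" where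
  "dihtpy X D p q \<longleftrightarrow> (\<exists>H :: real \<times> real \<Rightarrow> 'a.
     continuous_on ({0..1} \<times> {0..1}) H \<and> H ` ({0..1} \<times> {0..1}) \<subseteq> X \<and>
     (\<forall>\<gamma>. sq_dipath \<gamma> \<longrightarrow> H \<circ> \<gamma> \<in> D) \<and>
     (\<forall>t\<in>{0..1}. H (0, t) = p t \<and> H (1, t) = q t) \<and>
     (\<forall>s\<in>{0..1}. H (s, 0) = p 0 \<and> H (s, 1) = p 1))"

definition direl :: "'a::topological_space set \<Rightarrow> (real \<Rightarrow> 'a) set \<Rightarrow> ((real \<Rightarrow> 'a) \<times> (real \<Rightarrow> 'a)) set" where
  "direl X D = (let R = {(p, q). p \<in> D \<and> q \<in> D \<and> dihtpy X D p q}
                in {(p, q). p \<in> D \<and> q \<in> D \<and> (p, q) \<in> (R \<union> R\<inverse>)\<^sup>*})"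

definition dclass :: "'a::topological_space set \<Rightarrow> (real \<Rightarrow> 'a) set \<Rightarrow> (real \<Rightarrow> 'a) \<Rightarrow> (real \<Rightarrow> 'a) set" where
  "dclass X D p = {q. (p, q) \<in> direl X D}"

record ('o, 'm) cat =
  Obj :: "'o set"
  Mor :: "'m set"
  Dom :: "'m \<Rightarrow> 'o"
  Cod :: "'m \<Rightarrow> 'o"
  Id :: "'o \<Rightarrow> 'm"
  Comp :: "'m \<Rightarrow> 'm \<Rightarrow> 'm"   \<comment> \<open>Comp g f = g after f\<close>

definition hom :: "('o, 'm, 'x) cat_scheme \<Rightarrow> 'o \<Rightarrow> 'o \<Rightarrow> 'm set" where
  "hom C x y = {f \<in> Mor C. Dom C f = x \<and> Cod C f = y}"

definition category :: "('o, 'm, 'x) cat_scheme \<Rightarrow> bool" where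
  "category C \<longleftrightarrow>
     (\<forall>f\<in>Mor C. Dom C f \<in> Obj C \<and> Cod C f \<in> Obj C) \<and>
     (\<forall>x\<in>Obj C. Id C x \<in> hom C x x) \<and>
     (\<forall>f\<in>Mor C. \<forall>g\<in>Mor C. Cod C f = Dom C g \<longrightarrow> Comp C g f \<in> hom C (Dom C f) (Cod C g)) \<and>
     (\<forall>f\<in>Mor C. Comp C f (Id C (Dom C f)) = f \<and> Comp C (Id C (Cod C f)) f = f) \<and>
     (\<forall>f\<in>Mor C. \<forall>g\<in>Mor C. \<forall>h\<in>Mor C. Cod C f = Dom C g \<and> Cod C g = Dom C h \<longrightarrow>
        Comp C h (Comp C g f) = Comp C (Comp C h g) f)"

type_synonym ('o1, 'm1, 'o2, 'm2) ftr = "('o1 \<Rightarrow> 'o2) \<times> ('m1 \<Rightarrow> 'm2)"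

definition is_functor :: "('o1, 'm1, 'x) cat_scheme \<Rightarrow> ('o2, 'm2, 'y) cat_scheme \<Rightarrow> ('o1, 'm1, 'o2, 'm2) ftr \<Rightarrow> bool" where
  "is_functor C E F \<longleftrightarrow>
     (\<forall>x\<in>Obj C. fst F x \<in> Obj E) \<and>
     (\<forall>f\<in>Mor C. snd F f \<in> hom E (fst F (Dom C f)) (fst F (Cod C f))) \<and>
     (\<forall>x\<in>Obj C. snd F (Id C x) = Id E (fst F x)) \<and>
     (\<forall>f\<in>Mor C. \<forall>g\<in>Mor C. Cod C f = Dom C g \<longrightarrow> snd F (Comp C g f) = Comp E (snd F g) (snd F f))"

definition fcomp :: "('o2, 'm2, 'o3, 'm3) ftr \<Rightarrow> ('o1, 'm1, 'o2, 'm2) ftr \<Rightarrow> ('o1, 'm1, 'o3, 'm3) ftr"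
  (infixl \<open>\<circ>\<^sub>F\<close> 55) where
  "G \<circ>\<^sub>F F = (fst G \<circ> fst F, snd G \<circ> snd F)"

definition fun_eq_on :: "('o1, 'm1, 'x) cat_scheme \<Rightarrow> ('o1, 'm1, 'o2, 'm2) ftr \<Rightarrow> ('o1, 'm1, 'o2, 'm2) ftr \<Rightarrow> bool" where
  "fun_eq_on C F G \<longleftrightarrow> (\<forall>x\<in>Obj C. fst F x = fst G x) \<and> (\<forall>f\<in>Mor C. snd F f = snd G f)"

text \<open>Pushout of categories: commutative square C0 -> C1, C2 -> C, universal among all
  cocones into categories whose objects/morphisms live in the types of the given itself-argument
  (in a theorem these type variables are arbitrary, giving the universal property for every
  category).\<close>
definition is_pushout ::
  "('oe, 'me) cat itself \<Rightarrow> ('o0, 'm0, 'x0) cat_scheme \<Rightarrow> ('o1, 'm1, 'x1) cat_scheme \<Rightarrow> ('o2, 'm2, 'x2) cat_scheme \<Rightarrow> ('o, 'm, 'x) cat_scheme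
   \<Rightarrow> ('o0, 'm0, 'o1, 'm1) ftr \<Rightarrow> ('o0, 'm0, 'o2, 'm2) ftr
   \<Rightarrow> ('o1, 'm1, 'o, 'm) ftr \<Rightarrow> ('o2, 'm2, 'o, 'm) ftr \<Rightarrow> bool" where
  "is_pushout T C0 C1 C2 C F1 F2 G1 G2 \<longleftrightarrow>
     category C0 \<and> category C1 \<and> category C2 \<and> category C \<and>
     is_functor C0 C1 F1 \<and> is_functor C0 C2 F2 \<and> is_functor C1 C G1 \<and> is_functor C2 C G2 \<and>
     fun_eq_on C0 (G1 \<circ>\<^sub>F F1) (G2 \<circ>\<^sub>F F2) \<and>
     (\<forall>(E :: ('oe, 'me) cat) H1 H2.
        category E \<and> is_functor C1 E H1 \<and> is_functor C2 E H2 \<and> fun_eq_on C0 (H1 \<circ>\<^sub>F F1) (H2 \<circ>\<^sub>F F2) \<longrightarrow>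
        (\<exists>H. is_functor C E H \<and> fun_eq_on C1 (H \<circ>\<^sub>F G1) H1 \<and> fun_eq_on C2 (H \<circ>\<^sub>F G2) H2 \<and>
             (\<forall>H'. is_functor C E H' \<and> fun_eq_on C1 (H' \<circ>\<^sub>F G1) H1 \<and> fun_eq_on C2 (H' \<circ>\<^sub>F G2) H2
                   \<longrightarrow> fun_eq_on C H H')))"

type_synonym 'a dmor = "'a \<times> 'a \<times> (real \<Rightarrow> 'a) set"

definition rep :: "(real \<Rightarrow> 'a) set \<Rightarrow> real \<Rightarrow> 'a" where
  "rep C = (SOME p. p \<in> C)"

definition fund_cat :: "'a::topological_space set \<Rightarrow> (real \<Rightarrow> 'a) set \<Rightarrow> 'a set \<Rightarrow> ('a, 'a dmor) cat" where
  "fund_cat X D A = \<lparr>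
     Obj = A,
     Mor = {(a, b, dclass X D p) | a b p. a \<in> A \<and> b \<in> A \<and> p \<in> D \<and> p 0 = a \<and> p 1 = b},
     Dom = (\<lambda>f. fst f),
     Cod = (\<lambda>f. fst (snd f)),
     Id = (\<lambda>a. (a, a, dclass X D (\<lambda>t. a))),
     Comp = (\<lambda>g f. (fst f, fst (snd g), dclass X D (rep (snd (snd f)) +++ rep (snd (snd g)))))\<rparr>"

definition fc :: "(real \<Rightarrow> 'a::topological_space) set \<Rightarrow> 'a set \<Rightarrow> 'a set \<Rightarrow> ('a, 'a dmor) cat" where
  "fc D Y A = fund_cat Y (dsub D Y) A"

definition incl :: "(real \<Rightarrow> 'a::topological_space) set \<Rightarrow> 'a set \<Rightarrow> ('a, 'a dmor, 'a, 'a dmor) ftr" where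
  "incl D Z = (\<lambda>x. x, \<lambda>f. (fst f, fst (snd f), dclass Z (dsub D Z) (rep (snd (snd f)))))"

text \<open>CA is the full subcategory of CB on a subset of objects (inclusion iota acts as identity
  on morphism triples). P : CB -> CA is a future retract with unit eta: P is left adjoint to
  the inclusion, with unit eta (natural, universal), and eta a = id for a in CA.\<close>
definition future_retract :: "('o, 'm) cat \<Rightarrow> ('o, 'm) cat \<Rightarrow> ('o, 'm, 'o, 'm) ftr \<Rightarrow> ('o \<Rightarrow> 'm) \<Rightarrow> bool" where
  "future_retract CB CA P \<eta> \<longleftrightarrow>
     is_functor CB CA P \<and>
     (\<forall>b\<in>Obj CB. \<eta> b \<in> hom CB b (fst P b)) \<and>
     (\<forall>f\<in>Mor CB. Comp CB (snd P f) (\<eta> (Dom CB f)) = Comp CB (\<eta> (Cod CB f)) f) \<and>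
     (\<forall>b\<in>Obj CB. \<forall>a\<in>Obj CA. \<forall>f\<in>hom CB b a. \<exists>!g. g \<in> hom CA (fst P b) a \<and> Comp CB g (\<eta> b) = f) \<and>
     (\<forall>a\<in>Obj CA. \<eta> a = Id CB a)"

definition past_retract :: "('o, 'm) cat \<Rightarrow> ('o, 'm) cat \<Rightarrow> ('o, 'm, 'o, 'm) ftr \<Rightarrow> ('o \<Rightarrow> 'm) \<Rightarrow> bool" where
  "past_retract CB CA P \<epsilon> \<longleftrightarrow>
     is_functor CB CA P \<and>
     (\<forall>b\<in>Obj CB. \<epsilon> b \<in> hom CB (fst P b) b) \<and>
     (\<forall>f\<in>Mor CB. Comp CB f (\<epsilon> (Dom CB f)) = Comp CB (\<epsilon> (Cod CB f)) (snd P f)) \<and>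
     (\<forall>b\<in>Obj CB. \<forall>a\<in>Obj CA. \<forall>f\<in>hom CB a b. \<exists>!g. g \<in> hom CA a (fst P b) \<and> Comp CB (\<epsilon> b) g = f) \<and>
     (\<forall>a\<in>Obj CA. \<epsilon> a = Id CB a)"

definition retract :: "bool \<Rightarrow> ('o, 'm) cat \<Rightarrow> ('o, 'm) cat \<Rightarrow> ('o, 'm, 'o, 'm) ftr \<Rightarrow> ('o \<Rightarrow> 'm) \<Rightarrow> bool" where
  "retract fut CB CA P u = (if fut then future_retract CB CA P u else past_retract CB CA P u)"

end

theory Submission
  imports Defs
begin

text \<open>A functor out of the fundamental category of \<open>X\<close> is determined on a dipath by cutting it into
  pieces inside \<open>X1\<close> or \<open>X2\<close>, and the resulting composite is invariant under directed homotopy because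
  a directed square can be cut into small squares, each of which commutes in one of the two parts:
  any two monotone paths in a box with the same endpoints are dihomotopic. This is van Kampen's
  theorem with all points as base points. The levels of the chains are then reached by induction.
  A future or past retract restricts to the identity on its subcategory, so the square at level
  \<open>l\<close> is a retract of the square at level \<open>l - 1\<close>, and a retract of a pushout is a pushout. The units
  of the given retracts glue; the result is natural since it is natural on generators.\<close>

section \<open>Directed maps and monotone paths\<close>

lemma d_space_continuous: "d_space X D \<Longrightarrow> p \<in> D \<Longrightarrow> continuous_on {0..1} p"
  and d_space_image: "d_space X D \<Longrightarrow> p \<in> D \<Longrightarrow> p ` {0..1} \<subseteq> X"
  and d_space_const: "d_space X D \<Longrightarrow> x \<in> X \<Longrightarrow> (\<lambda>t. x) \<in> D"
  and d_space_join: "d_space X D \<Longrightarrow> p \<in> D \<Longrightarrow> q \<in> D \<Longrightarrow> p 1 = q 0 \<Longrightarrow> p +++ q \<in> D"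
  unfolding d_space_def by blast+

lemma d_space_endpoints:
  assumes "d_space X D" "p \<in> D"
  shows "p 0 \<in> X" "p 1 \<in> X"
  using d_space_image[OF assms] by auto

lemma joinpaths_endpoints [simp]: "(p +++ q) 0 = p 0" "(p +++ q) 1 = q 1"
  by (simp_all add: joinpaths_def)

lemma joinpaths_image_subset:
  "p ` {0..1} \<subseteq> S \<Longrightarrow> q ` {0..1} \<subseteq> S \<Longrightarrow> (p +++ q) ` {0..1} \<subseteq> S"
  by (auto simp: joinpaths_def image_subset_iff)

definition mono_paths :: "'b::{topological_space, order} set \<Rightarrow> (real \<Rightarrow> 'b) set" where
  "mono_paths S = {\<gamma>. continuous_on {0..1} \<gamma> \<and> \<gamma> ` {0..1} \<subseteq> S \<and> mono_on {0..1} \<gamma>}"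

lemma mono_pathsD:
  assumes "\<gamma> \<in> mono_paths S"
  shows "continuous_on {0..1} \<gamma>" "\<And>t. t \<in> {0..1} \<Longrightarrow> \<gamma> t \<in> S"
    "\<And>s t. 0 \<le> s \<Longrightarrow> s \<le> t \<Longrightarrow> t \<le> 1 \<Longrightarrow> \<gamma> s \<le> \<gamma> t"
  using assms by (auto simp: mono_paths_def mono_on_def)

lemma mono_paths_intervalI:
  assumes "continuous_on {0..1} \<gamma>" "\<And>s t. 0 \<le> s \<Longrightarrow> s \<le> t \<Longrightarrow> t \<le> 1 \<Longrightarrow> \<gamma> s \<le> \<gamma> t"
    and "a \<le> \<gamma> 0" "\<gamma> 1 \<le> b"
  shows "\<gamma> \<in> mono_paths {a..b}"
proof -
  have "a \<le> \<gamma> t \<and> \<gamma> t \<le> b" if "t \<in> {0..1}" for t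
    using that assms(2)[of 0 t] assms(2)[of t 1] assms(3,4) by (auto intro: order_trans)
  thus ?thesis using assms(1,2) by (auto simp: mono_paths_def intro: mono_onI)
qed

lemma mono_paths_mono: "S \<subseteq> T \<Longrightarrow> mono_paths S \<subseteq> mono_paths T"
  by (auto simp: mono_paths_def)

lemma mono_paths_cong:
  assumes "\<gamma> \<in> mono_paths S" "\<And>t. t \<in> {0..1} \<Longrightarrow> \<delta> t = \<gamma> t"
  shows "\<delta> \<in> mono_paths S"
  using assms continuous_on_eq[of "{0..1}" \<gamma> \<delta>] by (auto simp: mono_paths_def mono_on_def)

lemma mono_paths_ident: "(\<lambda>t. t) \<in> mono_paths {0..1::real}"
  by (rule mono_paths_intervalI) auto

lemma linepath_mono:
  fixes a b a' b' :: "'b::ordered_euclidean_space"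
  assumes "a \<le> b" "a \<le> a'" "b \<le> b'" and "s \<le> s'" "0 \<le> s'" "s' \<le> 1"
  shows "linepath a b s \<le> linepath a' b' s'"
proof -
  have "linepath a b s = a + s *\<^sub>R (b - a)" by (simp add: linepath_def algebra_simps)
  also have "\<dots> \<le> a + s' *\<^sub>R (b - a)"
    using assms by (intro add_left_mono scaleR_right_mono) auto
  also have "\<dots> = (1 - s') *\<^sub>R a + s' *\<^sub>R b" by (simp add: algebra_simps)
  also have "\<dots> \<le> linepath a' b' s'"
    unfolding linepath_def using assms by (intro add_mono scaleR_left_mono) auto
  finally show ?thesis .
qed

lemma linepath_mono_path:
  fixes a b :: "'b::ordered_euclidean_space"
  assumes "c \<le> a" "a \<le> b" "b \<le> d"
  shows "linepath a b \<in> mono_paths {c..d}"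
  using assms
  by (intro mono_paths_intervalI linepath_mono continuous_on_linepath)
    (auto simp: linepath_0' linepath_1')

lemma d_space_mono_paths: "d_space S (mono_paths S)"
  unfolding d_space_def
proof (intro conjI ballI allI impI)
  fix p \<phi> assume "p \<in> mono_paths S"
    and "continuous_on {0..1} \<phi> \<and> \<phi> ` {0..1} \<subseteq> {0..1} \<and> mono_on {0..1} (\<phi> :: real \<Rightarrow> real)"
  thus "p \<circ> \<phi> \<in> mono_paths S"
    by (auto simp: mono_paths_def mono_on_def image_subset_iff
        intro: continuous_on_compose2[of "{0..1}" p])
next
  fix p q assume p: "p \<in> mono_paths S" and q: "q \<in> mono_paths S" and ends: "p 1 = q 0"
  have "continuous_on {0..1} (p +++ q)"
    using p q ends path_join_imp[of p q]
    by (auto simp: mono_paths_def path_def pathfinish_def pathstart_def)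
  moreover have "(p +++ q) ` {0..1} \<subseteq> S"
    using p q by (intro joinpaths_image_subset) (auto simp: mono_paths_def)
  moreover have "(p +++ q) s \<le> (p +++ q) t" if "0 \<le> s" "s \<le> t" "t \<le> 1" for s t
  proof -
    consider (first) "t \<le> 1/2" | (both) "s \<le> 1/2" "1/2 < t" | (second) "1/2 < s" by linarith
    thus ?thesis
    proof cases
      case both
      hence "p (2 * s) \<le> q 0" "q 0 \<le> q (2 * t - 1)"
        using that mono_pathsD(3)[OF p, of "2 * s" 1] mono_pathsD(3)[OF q, of 0 "2 * t - 1"] ends
        by auto
      thus ?thesis using both by (auto simp: joinpaths_def)
    qed (use that mono_pathsD(3)[OF p] mono_pathsD(3)[OF q] in \<open>auto simp: joinpaths_def\<close>)
  qed
  ultimately show "p +++ q \<in> mono_paths S" by (auto simp: mono_paths_def intro: mono_onI)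
qed (auto simp: mono_paths_def mono_on_def)

lemma d_space_reparam: "d_space X D \<Longrightarrow> p \<in> D \<Longrightarrow> \<phi> \<in> mono_paths {0..1} \<Longrightarrow> p \<circ> \<phi> \<in> D"
  by (auto simp: d_space_def mono_paths_def)

definition d_map :: "'a::topological_space set \<Rightarrow> (real \<Rightarrow> 'a) set \<Rightarrow>
    'b::topological_space set \<Rightarrow> (real \<Rightarrow> 'b) set \<Rightarrow> ('a \<Rightarrow> 'b) \<Rightarrow> bool" where
  "d_map X D Y E f \<longleftrightarrow> continuous_on X f \<and> f ` X \<subseteq> Y \<and> (\<forall>p\<in>D. f \<circ> p \<in> E)"

lemma d_mapD:
  assumes "d_map X D Y E f"
  shows "continuous_on X f" "f ` X \<subseteq> Y" "\<And>p. p \<in> D \<Longrightarrow> f \<circ> p \<in> E"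
  using assms by (auto simp: d_map_def)

lemma d_map_comp:
  assumes "d_map X D Y E f" "d_map Y E Z F g"
  shows "d_map X D Z F (g \<circ> f)"
proof -
  have "continuous_on X (g \<circ> f)"
    using assms unfolding d_map_def by (meson continuous_on_compose continuous_on_subset)
  moreover have "(g \<circ> f) ` X \<subseteq> Z" using assms by (auto simp: d_map_def image_subset_iff)
  moreover have "(g \<circ> f) \<circ> p \<in> F" if "p \<in> D" for p
    using assms that by (simp add: d_map_def o_assoc[symmetric])
  ultimately show ?thesis by (simp add: d_map_def)
qed

lemma d_map_mono_paths:
  assumes "continuous_on S f" "f ` S \<subseteq> T"
    and mono: "\<And>x y. x \<in> S \<Longrightarrow> y \<in> S \<Longrightarrow> x \<le> y \<Longrightarrow> f x \<le> f y"
  shows "d_map S (mono_paths S) T (mono_paths T) f"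
proof -
  have "f \<circ> \<gamma> \<in> mono_paths T" if \<gamma>: "\<gamma> \<in> mono_paths S" for \<gamma>
  proof -
    have "continuous_on {0..1} (f \<circ> \<gamma>)"
      using assms(1) \<gamma> unfolding mono_paths_def
      by (blast intro: continuous_on_compose continuous_on_subset)
    thus ?thesis using assms(2) mono mono_pathsD[OF \<gamma>] unfolding mono_paths_def
      by (auto intro!: mono_onI)
  qed
  thus ?thesis using assms(1,2) by (simp add: d_map_def)
qed

lemma d_map_dipath:
  assumes "d_space X D" "p \<in> D"
  shows "d_map {0..1} (mono_paths {0..1}) X D p"
  using d_space_continuous[OF assms] d_space_image[OF assms] d_space_reparam[OF assms]
  by (simp add: d_map_def)

lemma d_map_restrict:
  assumes f: "d_map S (mono_paths S) X D f" and "T \<subseteq> S" "f ` T \<subseteq> Y"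
  shows "d_map T (mono_paths T) Y (dsub D Y) f"
proof -
  have "f \<circ> \<gamma> \<in> dsub D Y" if \<gamma>: "\<gamma> \<in> mono_paths T" for \<gamma>
  proof -
    have "f \<circ> \<gamma> \<in> D" using d_mapD(3)[OF f] \<gamma> mono_paths_mono[OF \<open>T \<subseteq> S\<close>] by blast
    thus ?thesis using mono_pathsD(2)[OF \<gamma>] \<open>f ` T \<subseteq> Y\<close> by (auto simp: dsub_def)
  qed
  thus ?thesis
    using d_mapD(1)[OF f] assms(2,3) by (auto simp: d_map_def intro: continuous_on_subset)
qed

lemma d_space_dsub:
  assumes X: "d_space X D" and "Y \<subseteq> X"
  shows "d_space Y (dsub D Y)"
  unfolding d_space_def
proof (intro conjI ballI allI impI)
  fix p q assume "p \<in> dsub D Y" "q \<in> dsub D Y" "p 1 = q 0"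
  thus "p +++ q \<in> dsub D Y"
    using d_space_join[OF X] by (auto simp: dsub_def joinpaths_image_subset)
next
  fix p \<phi> assume "p \<in> dsub D Y"
    and "continuous_on {0..1} \<phi> \<and> \<phi> ` {0..1} \<subseteq> {0..1} \<and> mono_on {0..1} (\<phi> :: real \<Rightarrow> real)"
  thus "p \<circ> \<phi> \<in> dsub D Y"
    using X by (auto simp: dsub_def d_space_def image_subset_iff)
qed (use assms in \<open>auto simp: dsub_def d_space_def\<close>)

lemma dsub_self: "d_space X D \<Longrightarrow> dsub D X = D"
  by (auto simp: dsub_def d_space_def)

lemma dsub_mono: "Y \<subseteq> Z \<Longrightarrow> dsub D Y \<subseteq> dsub D Z"
  by (auto simp: dsub_def)

lemma d_map_dsub_inclusion: "Y \<subseteq> Z \<Longrightarrow> d_map Y (dsub D Y) Z (dsub D Z) (\<lambda>x. x)"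
  by (auto simp: d_map_def dsub_def comp_def)

text \<open>The library's \<open>subpath\<close> is restricted to paths in normed spaces.\<close>
definition subdipath :: "real \<Rightarrow> real \<Rightarrow> (real \<Rightarrow> 'a) \<Rightarrow> real \<Rightarrow> 'a" where
  "subdipath a b p = p \<circ> linepath a b"

lemma subdipath_trivial [simp]: "subdipath 0 1 p = p"
  by (auto simp: subdipath_def linepath_def)

lemma subdipath_endpoints [simp]: "subdipath a b p 0 = p a" "subdipath a b p 1 = p b"
  by (simp_all add: subdipath_def linepath_0' linepath_1')

lemma subdipath_joinpaths_left:
  assumes "t \<in> {0..1}"
  shows "subdipath 0 (1/2) (p +++ q) t = p t"
  using assms by (simp add: subdipath_def linepath_def joinpaths_def)

lemma subdipath_joinpaths_right:
  assumes "p 1 = q 0" "t \<in> {0..1}"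
  shows "subdipath (1/2) 1 (p +++ q) t = q t"
proof -
  have "linepath (1/2) 1 t = 1/2 + t/2" by (simp add: linepath_def field_simps)
  hence "subdipath (1/2) 1 (p +++ q) t = (p +++ q) (1/2 + t/2)" by (simp only: subdipath_def comp_def)
  thus ?thesis using assms by (cases "t = 0") (simp_all add: joinpaths_def)
qed

lemma subdipath_image: "a \<le> b \<Longrightarrow> subdipath a b p ` {0..1} = p ` {a..b}"
  unfolding subdipath_def image_comp[symmetric] linepath_image_01
  by (simp add: closed_segment_eq_real_ivl)

lemma subdipath_subdipath:
  "subdipath a b (subdipath c d p) = subdipath (linepath c d a) (linepath c d b) p"
  by (auto simp: subdipath_def linepath_def algebra_simps)

lemma linepath_ratio:
  fixes a b x :: real
  assumes "a \<noteq> b"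
  shows "linepath a b ((x - a) / (b - a)) = x"
proof -
  have "linepath a b ((x - a) / (b - a)) = a + (x - a) / (b - a) * (b - a)"
    by (simp only: linepath_def real_scaleR_def) (simp only: algebra_simps)
  thus ?thesis using assms by simp
qed

lemma range_subdipath:
  assumes "a \<noteq> b"
  shows "range (subdipath a b p) = range p"
proof -
  have "range (linepath a b) = UNIV" using linepath_ratio[OF assms] by (metis surj_def)
  thus ?thesis unfolding subdipath_def image_comp[symmetric] by simp
qed

lemma d_map_subinterval:
  assumes "d_space X D" "p \<in> D" "0 \<le> a" "b \<le> 1" "p ` {a..b} \<subseteq> Y"
  shows "d_map {a..b} (mono_paths {a..b}) Y (dsub D Y) p"
  using assms by (intro d_map_restrict[OF d_map_dipath]) auto

lemma subdipath_in_dsub: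
  assumes "d_space X D" "p \<in> D" "0 \<le> a" "a \<le> b" "b \<le> 1" "p ` {a..b} \<subseteq> Y"
  shows "subdipath a b p \<in> dsub D Y"
  unfolding subdipath_def using assms
  by (intro d_mapD(3)[OF d_map_subinterval[of X D p a b]] linepath_mono_path) auto

lemma subdipath_in_d_space:
  assumes "d_space X D" "p \<in> D" "0 \<le> a" "a \<le> b" "b \<le> 1"
  shows "subdipath a b p \<in> D"
proof -
  have "p ` {a..b} \<subseteq> X" using assms d_space_image[OF assms(1,2)] by auto
  thus ?thesis using subdipath_in_dsub[OF assms] by (simp add: dsub_def)
qed

section \<open>Directed homotopy\<close>

lemma dihtpy_endpoints: "dihtpy X D p q \<Longrightarrow> q 0 = p 0 \<and> q 1 = p 1"
  unfolding dihtpy_def by (metis atLeastAtMost_iff order_refl zero_le_one)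

lemma direl_dihtpy: "p \<in> D \<Longrightarrow> q \<in> D \<Longrightarrow> dihtpy X D p q \<Longrightarrow> (p, q) \<in> direl X D"
  and direl_refl: "p \<in> D \<Longrightarrow> (p, p) \<in> direl X D"
  and direl_trans: "(p, q) \<in> direl X D \<Longrightarrow> (q, r) \<in> direl X D \<Longrightarrow> (p, r) \<in> direl X D"
  and direl_mem: "(p, q) \<in> direl X D \<Longrightarrow> p \<in> D \<and> q \<in> D"
  by (auto simp: direl_def Let_def)

lemma direl_sym:
  assumes "(p, q) \<in> direl X D"
  shows "(q, p) \<in> direl X D"
proof -
  let ?R = "{(p, q). p \<in> D \<and> q \<in> D \<and> dihtpy X D p q}"
  have "sym ((?R \<union> ?R\<inverse>)\<^sup>*)" by (intro sym_rtrancl sym_Un_converse)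
  thus ?thesis using assms by (auto simp: direl_def Let_def dest: symD)
qed

lemma direl_induct [consumes 1, case_names dihtpy refl sym trans]:
  assumes "(p, q) \<in> direl X D"
    and dihtpy: "\<And>p q. p \<in> D \<Longrightarrow> q \<in> D \<Longrightarrow> dihtpy X D p q \<Longrightarrow> S p q"
    and refl: "\<And>p. p \<in> D \<Longrightarrow> S p p"
    and sym: "\<And>p q. S p q \<Longrightarrow> S q p"
    and trans: "\<And>p q r. S p q \<Longrightarrow> S q r \<Longrightarrow> S p r"
  shows "S p q"
proof -
  let ?R = "{(p, q). p \<in> D \<and> q \<in> D \<and> dihtpy X D p q}"
  have "p \<in> D" "(p, q) \<in> (?R \<union> ?R\<inverse>)\<^sup>*" using assms(1) by (auto simp: direl_def Let_def)
  from this(2,1) show ?thesis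
  proof (induction rule: rtrancl_induct)
    case base
    thus ?case by (rule refl)
  next
    case (step q r)
    hence "S q r" using dihtpy sym by auto
    thus ?case using step trans by blast
  qed
qed

lemma direl_endpoints: "(p, q) \<in> direl X D \<Longrightarrow> p 0 = q 0 \<and> p 1 = q 1"
  by (induction rule: direl_induct) (auto dest: dihtpy_endpoints)

lemma dclass_eqI: "(p, q) \<in> direl X D \<Longrightarrow> dclass X D p = dclass X D q"
  unfolding dclass_def by (blast intro: direl_trans direl_sym)

lemma rep_dclass: "p \<in> D \<Longrightarrow> (p, rep (dclass X D p)) \<in> direl X D"
  unfolding rep_def dclass_def mem_Collect_eq
  by (rule someI[of "\<lambda>q. (p, q) \<in> direl X D" p]) (rule direl_refl)

abbreviation unit_square :: "(real \<times> real) set" where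
  "unit_square \<equiv> {0..1} \<times> {0..1}"

abbreviation d_square ::
  "'a::topological_space set \<Rightarrow> (real \<Rightarrow> 'a) set \<Rightarrow> (real \<times> real \<Rightarrow> 'a) \<Rightarrow> bool" where
  "d_square \<equiv> d_map unit_square (mono_paths unit_square)"

lemma Times_interval_eq: "{a..b} \<times> {c..d} = {(a, c)..(b, d)}"
  by (simp add: atLeastAtMost_prod_eq)

lemma sq_dipath_iff_mono_path: "sq_dipath \<gamma> \<longleftrightarrow> \<gamma> \<in> mono_paths unit_square"
  by (auto simp: sq_dipath_def mono_paths_def mono_on_def less_eq_prod_def)

lemma d_square_snd: "d_square {0..1} (mono_paths {0..1}) snd"
  by (rule d_map_mono_paths) (auto intro: continuous_intros simp: less_eq_prod_def)

lemma d_square_swap: "d_square unit_square (mono_paths unit_square) prod.swap"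
  by (rule d_map_mono_paths) (auto intro: continuous_on_swap simp: less_eq_prod_def)

lemma dihtpy_iff_d_square:
  "dihtpy X D p q \<longleftrightarrow> (\<exists>H. d_square X D H \<and> (\<forall>t\<in>{0..1}. H (0, t) = p t \<and> H (1, t) = q t) \<and>
     (\<forall>s\<in>{0..1}. H (s, 0) = p 0 \<and> H (s, 1) = p 1))"
  unfolding dihtpy_def d_map_def sq_dipath_iff_mono_path by (simp add: Ball_def conj_assoc)

lemma dihtpy_d_map:
  assumes f: "d_map X D Y E f" and "dihtpy X D p q"
  shows "dihtpy Y E (f \<circ> p) (f \<circ> q)"
proof -
  obtain H where H: "d_square X D H" "\<forall>t\<in>{0..1}. H (0, t) = p t \<and> H (1, t) = q t"
    "\<forall>s\<in>{0..1}. H (s, 0) = p 0 \<and> H (s, 1) = p 1"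
    using assms(2) unfolding dihtpy_iff_d_square by blast
  have "d_square Y E (f \<circ> H)" by (rule d_map_comp[OF H(1) f])
  thus ?thesis unfolding dihtpy_iff_d_square using H(2,3) by (intro exI[of _ "f \<circ> H"]) auto
qed

lemma direl_transport:
  assumes "(p, q) \<in> direl X D" and "P p"
    and P_dihtpy: "\<And>p q. dihtpy X D p q \<Longrightarrow> P p \<longleftrightarrow> P q"
    and mem: "\<And>p. p \<in> D \<Longrightarrow> P p \<Longrightarrow> f p \<in> E"
    and dihtpy: "\<And>p q. p \<in> D \<Longrightarrow> P p \<Longrightarrow> dihtpy X D p q \<Longrightarrow> dihtpy Y E (f p) (f q)"
  shows "(f p, f q) \<in> direl Y E"
proof -
  have "P p = P q \<and> (P p \<longrightarrow> (f p, f q) \<in> direl Y E)"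
    using assms(1)
  proof (induction rule: direl_induct)
    case (dihtpy p q)
    thus ?case using P_dihtpy[of p q] mem assms(5) by (auto intro: direl_dihtpy)
  next
    case (refl p)
    thus ?case using mem by (auto intro: direl_refl)
  qed (blast intro: direl_sym direl_trans)+
  thus ?thesis using assms(2) by blast
qed

lemma direl_d_map:
  assumes f: "d_map X D Y E f" and "(p, q) \<in> direl X D"
  shows "(f \<circ> p, f \<circ> q) \<in> direl Y E"
  using assms(2)
  by (rule direl_transport[where P = "\<lambda>p. True" and f = "\<lambda>p. f \<circ> p"])
    (auto intro: dihtpy_d_map[OF f] d_mapD(3)[OF f])

lemma dihtpy_mono_paths_le:
  fixes a b :: "'b::ordered_euclidean_space"
  assumes \<alpha>: "\<alpha> \<in> mono_paths {a..b}" and \<beta>: "\<beta> \<in> mono_paths {a..b}"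
    and ends: "\<alpha> 0 = \<beta> 0" "\<alpha> 1 = \<beta> 1"
    and le: "\<And>t. t \<in> {0..1} \<Longrightarrow> \<alpha> t \<le> \<beta> t"
  shows "dihtpy {a..b} (mono_paths {a..b}) \<alpha> \<beta>"
proof -
  define H where "H = (\<lambda>x. linepath (\<alpha> (snd x)) (\<beta> (snd x)) (fst x))"
  have "d_square {a..b} (mono_paths {a..b}) H"
  proof (rule d_map_mono_paths)
    have "continuous_on unit_square (\<lambda>x. \<gamma> (snd x))" if "\<gamma> \<in> mono_paths {a..b}" for \<gamma>
      by (rule continuous_on_compose2[OF mono_pathsD(1)[OF that]]) (auto intro: continuous_intros)
    from this[OF \<alpha>] this[OF \<beta>] show "continuous_on unit_square H"
      unfolding H_def linepath_def by (intro continuous_intros)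
    show "H ` unit_square \<subseteq> {a..b}"
    proof (rule image_subsetI)
      fix x :: "real \<times> real" assume "x \<in> unit_square"
      hence "H x \<in> closed_segment (\<alpha> (snd x)) (\<beta> (snd x))" "\<alpha> (snd x) \<in> {a..b}" "\<beta> (snd x) \<in> {a..b}"
        using mono_pathsD(2)[OF \<alpha>] mono_pathsD(2)[OF \<beta>] by (auto simp: H_def linepath_in_path)
      thus "H x \<in> {a..b}" using closed_segment_subset convex_closed_interval by blast
    qed
    show "H x \<le> H y" if "x \<in> unit_square" "y \<in> unit_square" "x \<le> y" for x y
      using that mono_pathsD(3)[OF \<alpha>] mono_pathsD(3)[OF \<beta>] le
      unfolding H_def by (intro linepath_mono) (auto simp: less_eq_prod_def)
  qed
  thus ?thesis
    unfolding dihtpy_iff_d_square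
    by (intro exI[of _ H]) (auto simp: H_def ends linepath_0' linepath_1' linepath_refl)
qed

text \<open>Monotone paths with common endpoints need not be comparable, but both lie below their
  pointwise supremum; this yields a zigzag of two directed homotopies.\<close>
lemma direl_mono_paths:
  fixes a b :: "'b::ordered_euclidean_space"
  assumes \<alpha>: "\<alpha> \<in> mono_paths {a..b}" and \<beta>: "\<beta> \<in> mono_paths {a..b}"
    and ends: "\<alpha> 0 = \<beta> 0" "\<alpha> 1 = \<beta> 1"
  shows "(\<alpha>, \<beta>) \<in> direl {a..b} (mono_paths {a..b})"
proof -
  define \<sigma> where "\<sigma> = (\<lambda>t. sup (\<alpha> t) (\<beta> t))"
  have \<sigma>: "\<sigma> \<in> mono_paths {a..b}"
    unfolding \<sigma>_def
  proof (rule mono_paths_intervalI)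
    show "continuous_on {0..1} (\<lambda>t. sup (\<alpha> t) (\<beta> t))"
      using mono_pathsD(1)[OF \<alpha>] mono_pathsD(1)[OF \<beta>]
      unfolding continuous_on by (auto intro: tendsto_sup)
    show "sup (\<alpha> s) (\<beta> s) \<le> sup (\<alpha> t) (\<beta> t)" if "0 \<le> s" "s \<le> t" "t \<le> 1" for s t
      using mono_pathsD(3)[OF \<alpha> that] mono_pathsD(3)[OF \<beta> that] by (rule sup_mono)
    show "a \<le> sup (\<alpha> 0) (\<beta> 0)" "sup (\<alpha> 1) (\<beta> 1) \<le> b"
      using mono_pathsD(2)[OF \<alpha>, of 0] mono_pathsD(2)[OF \<alpha>, of 1] ends by simp_all
  qed
  have "(\<alpha>, \<sigma>) \<in> direl {a..b} (mono_paths {a..b})"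
    using ends by (intro direl_dihtpy dihtpy_mono_paths_le \<alpha> \<sigma>) (auto simp: \<sigma>_def)
  moreover have "(\<beta>, \<sigma>) \<in> direl {a..b} (mono_paths {a..b})"
    using ends by (intro direl_dihtpy dihtpy_mono_paths_le \<beta> \<sigma>) (auto simp: \<sigma>_def)
  ultimately show ?thesis by (blast intro: direl_trans direl_sym)
qed

lemma direl_reparam_eq:
  assumes X: "d_space X D" and p: "p \<in> D" and q: "q \<in> D"
    and \<phi>: "\<phi> \<in> mono_paths {0..1}" "\<phi> 0 = 0" "\<phi> 1 = 1"
    and eq: "\<And>t. t \<in> {0..1} \<Longrightarrow> q t = p (\<phi> t)"
  shows "(p, q) \<in> direl X D"
proof -
  have "((\<lambda>t. t), \<phi>) \<in> direl {0..1} (mono_paths {0..1})"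
    by (rule direl_mono_paths[OF mono_paths_ident \<phi>(1)]) (simp_all add: \<phi>)
  from direl_d_map[OF d_map_dipath[OF X p] this] have "(p, p \<circ> \<phi>) \<in> direl X D"
    by (simp add: comp_def)
  moreover have "dihtpy X D (p \<circ> \<phi>) q"
    unfolding dihtpy_iff_d_square
  proof (intro exI conjI)
    show "d_square X D (q \<circ> snd)"
      by (rule d_map_comp[OF d_square_snd d_map_dipath[OF X q]])
  qed (use eq in auto)
  hence "(p \<circ> \<phi>, q) \<in> direl X D" by (intro direl_dihtpy d_space_reparam[OF X p \<phi>(1)] q)
  ultimately show ?thesis by (rule direl_trans)
qed

lemma direl_eq_on:
  assumes "d_space X D" "p \<in> D" "q \<in> D" "\<And>t. t \<in> {0..1} \<Longrightarrow> p t = q t"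
  shows "(p, q) \<in> direl X D"
  using assms by (intro direl_reparam_eq[OF _ _ _ mono_paths_ident]) auto

lemma direl_join_assoc:
  assumes X: "d_space X D" and D: "p \<in> D" "q \<in> D" "r \<in> D" and ends: "p 1 = q 0" "q 1 = r 0"
  shows "((p +++ q) +++ r, p +++ (q +++ r)) \<in> direl X D"
proof (rule direl_reparam_eq[OF X])
  let ?\<phi> = "\<lambda>t::real. max (t / 2) (max (t - 1/4) (2 * t - 1))"
  show "(p +++ q) +++ r \<in> D" "p +++ (q +++ r) \<in> D"
    using D ends by (auto intro!: d_space_join[OF X])
  show "?\<phi> \<in> mono_paths {0..1}"
  proof (rule mono_paths_intervalI)
    show "?\<phi> s \<le> ?\<phi> t" if "s \<le> t" for s t using that by (intro max.mono) auto
  qed (auto intro!: continuous_intros)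
  show "(p +++ (q +++ r)) t = ((p +++ q) +++ r) (?\<phi> t)" if "t \<in> {0..1}" for t
  proof -
    consider (first) "t \<le> 1/2" "?\<phi> t = t / 2"
      | (second) "1/2 < t" "t \<le> 3/4" "?\<phi> t = t - 1/4"
      | (third) "3/4 < t" "?\<phi> t = 2 * t - 1"
      by linarith
    thus ?thesis
      by cases (simp_all add: joinpaths_def algebra_simps)
  qed
qed (auto simp: max_def)

lemma direl_join_const_right:
  assumes X: "d_space X D" and p: "p \<in> D"
  shows "(p, p +++ (\<lambda>t. p 1)) \<in> direl X D"
proof (rule direl_reparam_eq[OF X p])
  show "p +++ (\<lambda>t. p 1) \<in> D"
    using p d_space_endpoints[OF X p] by (intro d_space_join[OF X] d_space_const[OF X]) auto
  show "(\<lambda>t. min (2 * t) 1) \<in> mono_paths {0..1}"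
    by (rule mono_paths_intervalI) (auto intro!: continuous_intros)
qed (auto simp: joinpaths_def)

lemma direl_join_const_left:
  assumes X: "d_space X D" and p: "p \<in> D"
  shows "(p, (\<lambda>t. p 0) +++ p) \<in> direl X D"
proof (rule direl_reparam_eq[OF X p])
  show "(\<lambda>t. p 0) +++ p \<in> D"
    using p d_space_endpoints[OF X p] by (intro d_space_join[OF X] d_space_const[OF X]) auto
  show "(\<lambda>t. max (2 * t - 1) 0) \<in> mono_paths {0..1}"
    by (rule mono_paths_intervalI) (auto intro!: continuous_intros)
qed (auto simp: joinpaths_def)

lemma direl_subdipath_join:
  assumes X: "d_space X D" and p: "p \<in> D" and abc: "0 \<le> a" "a \<le> b" "b \<le> c" "c \<le> 1"
    and Y: "p ` {a..c} \<subseteq> Y"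
  shows "(subdipath a c p, subdipath a b p +++ subdipath b c p) \<in> direl Y (dsub D Y)"
proof -
  have "linepath a b \<in> mono_paths {a..c}" "linepath b c \<in> mono_paths {a..c}"
    using abc by (auto intro: linepath_mono_path)
  hence "linepath a b +++ linepath b c \<in> mono_paths {a..c}"
    by (rule d_space_join[OF d_space_mono_paths]) (simp add: linepath_0' linepath_1')
  hence "(linepath a c, linepath a b +++ linepath b c) \<in> direl {a..c} (mono_paths {a..c})"
    using abc by (intro direl_mono_paths linepath_mono_path) (auto simp: linepath_0' linepath_1')
  from direl_d_map[OF d_map_subinterval[OF X p _ _ Y] this] show ?thesis
    using abc by (simp add: subdipath_def path_compose_join)
qed

section \<open>Concatenation of directed homotopies\<close>

lemma d_space_reparam_eq_on:
  assumes X: "d_space X D" and r: "r \<in> D" and \<phi>: "\<phi> \<in> mono_paths {0..1}"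
    and eq: "\<And>t. t \<in> {0..1} \<Longrightarrow> f t = r (\<phi> t)" and range: "range f \<subseteq> range r"
  shows "f \<in> D"
proof -
  have "\<forall>t. \<exists>u. r u = f t" using range by (metis rangeE rangeI subsetD)
  then obtain w where w: "\<And>t. r (w t) = f t" by metis
  let ?\<psi> = "\<lambda>t. if t \<in> {0..1} then \<phi> t else w t"
  have "?\<psi> \<in> mono_paths {0..1}" by (rule mono_paths_cong[OF \<phi>]) simp
  from d_space_reparam[OF X r this] have "r \<circ> ?\<psi> \<in> D" .
  moreover have "r \<circ> ?\<psi> = f" using eq w by auto
  ultimately show ?thesis by simp
qed

text \<open>Dipaths are total functions on the reals and reparametrizations are unconstrained off the unit
  interval. Extending them by a logarithm makes every value of \<open>p\<close> and \<open>q\<close> available in a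
  concatenation.\<close>
lemma d_space_join_range:
  assumes X: "d_space X D" and p: "p \<in> D" and q: "q \<in> D" and ends: "p 1 = q 0"
  obtains r where "r \<in> D" "\<And>t. t \<in> {0..1} \<Longrightarrow> r t = (p +++ q) t" "range p \<union> range q \<subseteq> range r"
proof
  define \<phi> where "\<phi> = (\<lambda>t::real. if t < 0 then ln (- t) else t)"
  define \<psi> where "\<psi> = (\<lambda>t::real. if t > 1 then ln (t - 1) else t)"
  let ?r = "(p \<circ> \<phi>) +++ (q \<circ> \<psi>)"
  have "\<phi> \<in> mono_paths {0..1}" "\<psi> \<in> mono_paths {0..1}"
    by (rule mono_paths_cong[OF mono_paths_ident], simp add: \<phi>_def \<psi>_def)+
  thus "?r \<in> D"
    using ends by (intro d_space_join[OF X] d_space_reparam[OF X] p q) (simp_all add: \<phi>_def \<psi>_def)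
  show "?r t = (p +++ q) t" if "t \<in> {0..1}" for t
    using that by (simp add: joinpaths_def \<phi>_def \<psi>_def)
  have "p x = ?r (- exp x / 2)" for x
  proof -
    have "- exp x / 2 \<le> 1 / 2" using exp_gt_zero[of x] by linarith
    thus ?thesis by (simp add: joinpaths_def \<phi>_def)
  qed
  moreover have "q x = ?r (1 + exp x / 2)" for x
  proof -
    have "\<not> 1 + exp x / 2 \<le> 1 / 2" using exp_gt_zero[of x] by linarith
    thus ?thesis by (simp add: joinpaths_def \<psi>_def)
  qed
  ultimately show "range p \<union> range q \<subseteq> range ?r" by blast
qed

lemma join_subdipaths_reparam:
  fixes c :: real
  assumes c: "0 < c" "c < 1"
  obtains \<theta> where "\<theta> \<in> mono_paths {0..1}"
    "\<And>(p :: real \<Rightarrow> 'a::topological_space) q t. t \<in> {0..c} \<Longrightarrow>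
      (subdipath 0 c p +++ subdipath c 1 q) (\<theta> t) = p t"
    "\<And>(p :: real \<Rightarrow> 'a::topological_space) q t. t \<in> {c<..1} \<Longrightarrow>
      (subdipath 0 c p +++ subdipath c 1 q) (\<theta> t) = q t"
proof
  define \<theta> where "\<theta> t = (min t c / c + (max t c - c) / (1 - c)) / 2" for t
  show "\<theta> \<in> mono_paths {0..1}"
  proof (rule mono_paths_intervalI)
    show "continuous_on {0..1} \<theta>" unfolding \<theta>_def using c by (intro continuous_intros) auto
    show "\<theta> s \<le> \<theta> t" if "s \<le> t" for s t
      unfolding \<theta>_def using that c by (intro divide_right_mono add_mono) auto
    show "\<theta> 1 \<le> 1" using c by (simp add: \<theta>_def field_simps)
  qed (use c in \<open>simp add: \<theta>_def\<close>)
  fix p q :: "real \<Rightarrow> 'a" and t :: real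
  show "(subdipath 0 c p +++ subdipath c 1 q) (\<theta> t) = p t" if "t \<in> {0..c}"
  proof -
    have "\<theta> t = t / (2 * c)" "\<theta> t \<le> 1/2" using that c by (simp_all add: \<theta>_def field_simps)
    thus ?thesis using c by (simp add: joinpaths_def subdipath_def linepath_def)
  qed
  show "(subdipath 0 c p +++ subdipath c 1 q) (\<theta> t) = q t" if "t \<in> {c<..1}"
  proof -
    define u where "u = (t - c) / (1 - c)"
    have "\<theta> t = (1 + u) / 2" "0 < u" using that c by (simp_all add: \<theta>_def u_def)
    hence "\<not> \<theta> t \<le> 1/2" "2 * \<theta> t - 1 = u" by simp_all
    moreover have "linepath c 1 u = t" unfolding u_def using linepath_ratio[of c 1 t] c by simp
    ultimately show ?thesis by (simp add: joinpaths_def subdipath_def)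
  qed
qed

lemma d_space_glue:
  assumes X: "d_space X D" and p: "p \<in> D" and q: "q \<in> D" and c: "0 < c" "c < 1"
    and fp: "\<And>t. t \<in> {0..c} \<Longrightarrow> f t = p t" and fq: "\<And>t. t \<in> {c..1} \<Longrightarrow> f t = q t"
    and range: "range f \<subseteq> range p \<union> range q"
  shows "f \<in> D"
proof -
  let ?r = "subdipath 0 c p +++ subdipath c 1 q"
  have mem: "subdipath 0 c p \<in> D" "subdipath c 1 q \<in> D"
    using c by (auto intro!: subdipath_in_d_space[OF X] p q)
  have "subdipath 0 c p 1 = subdipath c 1 q 0" using fp[of c] fq[of c] c by simp
  from d_space_join_range[OF X mem this] obtain r where r: "r \<in> D" "\<And>t. t \<in> {0..1} \<Longrightarrow> r t = ?r t"
    and r_range: "range (subdipath 0 c p) \<union> range (subdipath c 1 q) \<subseteq> range r" by blast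
  obtain \<theta> where \<theta>: "\<theta> \<in> mono_paths {0..1}"
    and left: "\<And>p q t. t \<in> {0..c} \<Longrightarrow> (subdipath 0 c p +++ subdipath c 1 q) (\<theta> t) = (p t :: 'a)"
    and right: "\<And>p q t. t \<in> {c<..1} \<Longrightarrow> (subdipath 0 c p +++ subdipath c 1 q) (\<theta> t) = (q t :: 'a)"
    using join_subdipaths_reparam[OF c] by blast
  show ?thesis
  proof (rule d_space_reparam_eq_on[OF X r(1) \<theta>])
    show "f t = r (\<theta> t)" if t: "t \<in> {0..1}" for t
      using t fp fq left[of t p q] right[of t p q] r(2)[OF mono_pathsD(2)[OF \<theta> t]]
      by (cases "t \<le> c") auto
    show "range f \<subseteq> range r"
      using range r_range unfolding range_subdipath[OF less_imp_neq[OF c(1)]]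
        range_subdipath[OF less_imp_neq[OF c(2)]] by (rule order_trans)
  qed
qed

lemma mono_path_extend:
  fixes a b :: "'b::ordered_euclidean_space"
  assumes \<gamma>: "\<gamma> \<in> mono_paths {a..b}"
  obtains \<delta> \<phi> where "\<delta> \<in> mono_paths {a..b}" "\<delta> 0 = a" "\<delta> 1 = b" "range \<gamma> \<subseteq> range \<delta>"
    "\<phi> \<in> mono_paths {0..1}" "\<forall>t\<in>{0..1}. \<gamma> t = \<delta> (\<phi> t)"
proof -
  note box = d_space_mono_paths[of "{a..b}"]
  have "\<gamma> 0 \<in> {a..b}" "\<gamma> 1 \<in> {a..b}" using mono_pathsD(2)[OF \<gamma>] by auto
  hence lines: "linepath a (\<gamma> 0) \<in> mono_paths {a..b}" "linepath (\<gamma> 1) b \<in> mono_paths {a..b}"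
    by (auto intro: linepath_mono_path)
  obtain \<gamma>' where \<gamma>': "\<gamma>' \<in> mono_paths {a..b}" "range \<gamma> \<subseteq> range \<gamma>'"
    and \<gamma>'_eq: "\<And>t. t \<in> {0..1} \<Longrightarrow> \<gamma>' t = (\<gamma> +++ linepath (\<gamma> 1) b) t"
    using d_space_join_range[OF box \<gamma> lines(2)] by (metis Un_subset_iff linepath_0')
  have "linepath a (\<gamma> 0) 1 = \<gamma>' 0" using \<gamma>'_eq[of 0] by (simp add: linepath_1')
  then obtain \<delta> where \<delta>: "\<delta> \<in> mono_paths {a..b}" "range \<gamma>' \<subseteq> range \<delta>"
    and \<delta>_eq: "\<And>t. t \<in> {0..1} \<Longrightarrow> \<delta> t = (linepath a (\<gamma> 0) +++ \<gamma>') t"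
    using d_space_join_range[OF box lines(1) \<gamma>'(1)] by (metis Un_subset_iff)
  show ?thesis
  proof
    show "\<delta> \<in> mono_paths {a..b}" "range \<gamma> \<subseteq> range \<delta>" using \<delta> \<gamma>'(2) by auto
    show "\<delta> 0 = a" "\<delta> 1 = b" using \<delta>_eq \<gamma>'_eq by (simp_all add: linepath_0' linepath_1')
    show "linepath (1/2) (3/4) \<in> mono_paths {0..1::real}" by (rule linepath_mono_path) auto
    have "\<gamma> t = \<delta> (linepath (1/2) (3/4) t)" if "t \<in> {0..1}" for t
    proof (cases "t = 0")
      case False
      have "linepath (1/2) (3/4) t = 1/2 + t/4" by (simp add: linepath_def field_simps)
      thus ?thesis using that False \<delta>_eq[of "1/2 + t/4"] \<gamma>'_eq[of "t/2"]
        by (simp add: joinpaths_def)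
    qed (use \<delta>_eq[of "1/2"] in \<open>simp add: linepath_0' linepath_1' joinpaths_def\<close>)
    thus "\<forall>t\<in>{0..1}. \<gamma> t = \<delta> (linepath (1/2) (3/4) t)" by blast
  qed
qed

lemma d_space_paste_le:
  fixes h :: "real \<Rightarrow> real"
  assumes X: "d_space X D" and p: "p \<in> D" and q: "q \<in> D"
    and h: "h \<in> mono_paths S" and y: "h 0 < y" "y < h 1"
    and agree: "\<And>t. t \<in> {0..1} \<Longrightarrow> h t = y \<Longrightarrow> p t = q t"
  shows "(\<lambda>t. if h t \<le> y then p t else q t) \<in> D"
proof -
  obtain c where c: "0 \<le> c" "c \<le> 1" "h c = y"
    using IVT'[of h 0 y 1] y mono_pathsD(1)[OF h] by auto
  hence "c \<noteq> 0" "c \<noteq> 1" using y by auto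
  hence "0 < c" "c < 1" using c by auto
  thus ?thesis
  proof (rule d_space_glue[OF X p q])
    show "(if h t \<le> y then p t else q t) = p t" if "t \<in> {0..c}" for t
      using that c mono_pathsD(3)[OF h, of t c] by auto
    show "(if h t \<le> y then p t else q t) = q t" if "t \<in> {c..1}" for t
      using that c mono_pathsD(3)[OF h, of c t] agree[of t] by auto
  qed auto
qed

lemma d_square_paste:
  assumes X: "d_space X D" and H: "d_square X D H" and K: "d_square X D K"
    and agree: "\<And>x. x \<in> unit_square \<Longrightarrow> snd x = 1/2 \<Longrightarrow> H x = K x"
  shows "d_square X D (\<lambda>x. if snd x \<le> 1/2 then H x else K x)"
proof -
  define G where "G = (\<lambda>x::real \<times> real. if snd x \<le> 1/2 then H x else K x)"
  have "continuous_on unit_square G"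
    unfolding G_def
    using d_mapD(1)[OF H] d_mapD(1)[OF K] agree
    by (intro continuous_on_cases_le) (auto intro: continuous_on_subset continuous_intros)
  moreover have "G ` unit_square \<subseteq> X"
    using d_mapD(2)[OF H] d_mapD(2)[OF K] by (auto simp: G_def image_subset_iff)
  moreover have "G \<circ> \<gamma> \<in> D" if \<gamma>: "\<gamma> \<in> mono_paths unit_square" for \<gamma>
  proof -
    obtain \<delta> \<phi> where \<delta>: "\<delta> \<in> mono_paths unit_square" "\<delta> 0 = (0, 0)" "\<delta> 1 = (1, 1)"
      and range: "range \<gamma> \<subseteq> range \<delta>"
      and \<phi>: "\<phi> \<in> mono_paths {0..1}" "\<forall>t\<in>{0..1}. \<gamma> t = \<delta> (\<phi> t)"
      using \<gamma> unfolding Times_interval_eq by (rule mono_path_extend)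
    from d_space_paste_le[OF X d_mapD(3)[OF H \<delta>(1)] d_mapD(3)[OF K \<delta>(1)]
        d_mapD(3)[OF d_square_snd \<delta>(1)], of "1/2"]
    have "G \<circ> \<delta> \<in> D"
      using \<delta>(2,3) agree mono_pathsD(2)[OF \<delta>(1)] by (simp add: G_def comp_def cong: if_cong)
    thus ?thesis
    proof (rule d_space_reparam_eq_on[OF X _ \<phi>(1)])
      show "range (G \<circ> \<gamma>) \<subseteq> range (G \<circ> \<delta>)"
        using image_mono[OF range, of G] by (simp only: image_comp)
    qed (use \<phi>(2) in simp)
  qed
  ultimately show ?thesis unfolding d_map_def G_def by blast
qed

lemma dihtpy_join:
  assumes X: "d_space X D" and pp': "dihtpy X D p p'" and qq': "dihtpy X D q q'" and ends: "p 1 = q 0"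
  shows "dihtpy X D (p +++ q) (p' +++ q')"
proof -
  obtain H where H: "d_square X D H" "\<And>t. t \<in> {0..1} \<Longrightarrow> H (0, t) = p t \<and> H (1, t) = p' t"
     "\<And>s. s \<in> {0..1} \<Longrightarrow> H (s, 0) = p 0 \<and> H (s, 1) = p 1"
    using pp' unfolding dihtpy_iff_d_square by blast
  obtain K where K: "d_square X D K" "\<And>t. t \<in> {0..1} \<Longrightarrow> K (0, t) = q t \<and> K (1, t) = q' t"
     "\<And>s. s \<in> {0..1} \<Longrightarrow> K (s, 0) = q 0 \<and> K (s, 1) = q 1"
    using qq' unfolding dihtpy_iff_d_square by blast
  define lower where "lower = (\<lambda>x::real \<times> real. (fst x, min (2 * snd x) 1))"
  define upper where "upper = (\<lambda>x::real \<times> real. (fst x, max (2 * snd x - 1) 0))"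
  define G where "G = (\<lambda>x. if snd x \<le> 1/2 then (H \<circ> lower) x else (K \<circ> upper) x)"
  have "d_square unit_square (mono_paths unit_square) lower"
    "d_square unit_square (mono_paths unit_square) upper"
    unfolding lower_def upper_def
    by (intro d_map_mono_paths continuous_intros; auto simp: less_eq_prod_def)+
  moreover have "(H \<circ> lower) x = (K \<circ> upper) x" if "x \<in> unit_square" "snd x = 1/2" for x
  proof -
    have "lower x = (fst x, 1)" "upper x = (fst x, 0)"
      using that(2) by (simp_all add: lower_def upper_def)
    thus ?thesis using that(1) H(3) K(3) ends by (simp add: mem_Times_iff)
  qed
  ultimately have "d_square X D G"
    unfolding G_def by (intro d_square_paste[OF X] d_map_comp[OF _ H(1)] d_map_comp[OF _ K(1)])
  moreover have "\<forall>t\<in>{0..1}. G (0, t) = (p +++ q) t \<and> G (1, t) = (p' +++ q') t"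
    using H(2) K(2) by (auto simp: G_def lower_def upper_def joinpaths_def)
  moreover have "\<forall>s\<in>{0..1}. G (s, 0) = (p +++ q) 0 \<and> G (s, 1) = (p +++ q) 1"
    using H(3) K(3) by (auto simp: G_def lower_def upper_def)
  ultimately show ?thesis unfolding dihtpy_iff_d_square by blast
qed

lemma dihtpy_refl: "d_space X D \<Longrightarrow> p \<in> D \<Longrightarrow> dihtpy X D p p"
  unfolding dihtpy_iff_d_square
  by (intro exI[of _ "p \<circ> snd"] conjI d_map_comp[OF d_square_snd d_map_dipath]) auto

lemma direl_join_left:
  assumes X: "d_space X D" and "(p, p') \<in> direl X D" and q: "q \<in> D" and "p 1 = q 0"
  shows "(p +++ q, p' +++ q) \<in> direl X D"
  using assms(2,4)
proof (rule direl_transport)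
  show "p +++ q \<in> D" if "p \<in> D" "p 1 = q 0" for p
    by (rule d_space_join[OF X that(1) q that(2)])
  show "dihtpy X D (p +++ q) (p' +++ q)" if "p 1 = q 0" "dihtpy X D p p'" for p p'
    by (rule dihtpy_join[OF X that(2) dihtpy_refl[OF X q] that(1)])
qed (simp add: dihtpy_endpoints)

lemma direl_join_right:
  assumes X: "d_space X D" and "(q, q') \<in> direl X D" and p: "p \<in> D" and "p 1 = q 0"
  shows "(p +++ q, p +++ q') \<in> direl X D"
  using assms(2,4)
proof (rule direl_transport)
  show "p +++ q \<in> D" if "q \<in> D" "p 1 = q 0" for q
    by (rule d_space_join[OF X p that])
  show "dihtpy X D (p +++ q) (p +++ q')" if "p 1 = q 0" "dihtpy X D q q'" for q q'
    by (rule dihtpy_join[OF X dihtpy_refl[OF X p] that(2,1)])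
qed (simp add: dihtpy_endpoints)

lemma direl_join:
  assumes "d_space X D" "(p, p') \<in> direl X D" "(q, q') \<in> direl X D" "p 1 = q 0"
  shows "(p +++ q, p' +++ q') \<in> direl X D"
proof (rule direl_trans)
  show "(p +++ q, p' +++ q) \<in> direl X D"
    using assms direl_mem by (intro direl_join_left) auto
  show "(p' +++ q, p' +++ q') \<in> direl X D"
    using assms direl_mem direl_endpoints[OF assms(2)] by (intro direl_join_right) auto
qed

section \<open>Functors and full subcategories\<close>

lemma hom_memD: "f \<in> hom C x y \<Longrightarrow> f \<in> Mor C \<and> Dom C f = x \<and> Cod C f = y"
  and Mor_in_hom: "f \<in> Mor C \<Longrightarrow> f \<in> hom C (Dom C f) (Cod C f)"
  by (auto simp: hom_def)

lemma category_comp: "category C \<Longrightarrow> f \<in> hom C x y \<Longrightarrow> g \<in> hom C y z \<Longrightarrow> Comp C g f \<in> hom C x z"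
  and category_id: "category C \<Longrightarrow> a \<in> Obj C \<Longrightarrow> Id C a \<in> hom C a a"
  and category_id_right: "category C \<Longrightarrow> f \<in> hom C x y \<Longrightarrow> Comp C f (Id C x) = f"
  and category_id_left: "category C \<Longrightarrow> f \<in> hom C x y \<Longrightarrow> Comp C (Id C y) f = f"
  and category_dom: "category C \<Longrightarrow> f \<in> hom C x y \<Longrightarrow> x \<in> Obj C"
  and category_cod: "category C \<Longrightarrow> f \<in> hom C x y \<Longrightarrow> y \<in> Obj C"
  unfolding category_def hom_def by auto

lemma category_assoc:
  assumes "category C" "f \<in> hom C x y" "g \<in> hom C y z" "h \<in> hom C z w"
  shows "Comp C h (Comp C g f) = Comp C (Comp C h g) f"
  using assms unfolding category_def hom_def by auto

lemma functor_obj: "is_functor C E F \<Longrightarrow> x \<in> Obj C \<Longrightarrow> fst F x \<in> Obj E"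
  and functor_hom: "is_functor C E F \<Longrightarrow> f \<in> hom C x y \<Longrightarrow> snd F f \<in> hom E (fst F x) (fst F y)"
  and functor_mor: "is_functor C E F \<Longrightarrow> f \<in> Mor C \<Longrightarrow> snd F f \<in> Mor E"
  and functor_id: "is_functor C E F \<Longrightarrow> x \<in> Obj C \<Longrightarrow> snd F (Id C x) = Id E (fst F x)"
  by (auto simp: is_functor_def hom_def)

lemma functor_comp:
  "is_functor C E F \<Longrightarrow> f \<in> hom C x y \<Longrightarrow> g \<in> hom C y z \<Longrightarrow> snd F (Comp C g f) = Comp E (snd F g) (snd F f)"
  by (auto simp: is_functor_def hom_def)

lemma fcomp_apply [simp]: "fst (G \<circ>\<^sub>F F) x = fst G (fst F x)" "snd (G \<circ>\<^sub>F F) f = snd G (snd F f)"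
  by (simp_all add: fcomp_def)

lemma fcomp_assoc: "(H \<circ>\<^sub>F G) \<circ>\<^sub>F F = H \<circ>\<^sub>F (G \<circ>\<^sub>F F)"
  by (simp add: fcomp_def comp_assoc)

lemma functor_fcomp: "is_functor C E F \<Longrightarrow> is_functor E K G \<Longrightarrow> is_functor C K (G \<circ>\<^sub>F F)"
  unfolding is_functor_def hom_def by simp

lemma functor_ident: "is_functor C C (\<lambda>x. x, \<lambda>f. f)"
  by (auto simp: is_functor_def hom_def)

lemma fun_eq_on_obj: "fun_eq_on C F G \<Longrightarrow> x \<in> Obj C \<Longrightarrow> fst F x = fst G x"
  and fun_eq_on_mor: "fun_eq_on C F G \<Longrightarrow> f \<in> Mor C \<Longrightarrow> snd F f = snd G f"
  by (auto simp: fun_eq_on_def)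

lemma fun_eq_on_refl: "fun_eq_on C F F"
  and fun_eq_on_sym: "fun_eq_on C F G \<Longrightarrow> fun_eq_on C G F"
  and fun_eq_on_trans [trans]: "fun_eq_on C F G \<Longrightarrow> fun_eq_on C G H \<Longrightarrow> fun_eq_on C F H"
  by (auto simp: fun_eq_on_def)

lemma fun_eq_on_fcomp_left: "fun_eq_on C F G \<Longrightarrow> fun_eq_on C (H \<circ>\<^sub>F F) (H \<circ>\<^sub>F G)"
  by (auto simp: fun_eq_on_def)

lemma fun_eq_on_fcomp_right:
  assumes "is_functor B C F" "fun_eq_on C G H"
  shows "fun_eq_on B (G \<circ>\<^sub>F F) (H \<circ>\<^sub>F F)"
  using assms(2) functor_obj[OF assms(1)] functor_mor[OF assms(1)] by (auto simp: fun_eq_on_def)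

definition full_sub :: "('o, 'm) cat \<Rightarrow> ('o, 'm) cat \<Rightarrow> bool" where
  "full_sub B C \<longleftrightarrow> Obj B \<subseteq> Obj C \<and> Mor B = {f \<in> Mor C. Dom C f \<in> Obj B \<and> Cod C f \<in> Obj B} \<and>
     Dom B = Dom C \<and> Cod B = Cod C \<and> Id B = Id C \<and> Comp B = Comp C"

lemma full_sub_hom: "full_sub B C \<Longrightarrow> x \<in> Obj B \<Longrightarrow> y \<in> Obj B \<Longrightarrow> hom B x y = hom C x y"
  and full_sub_hom_subset: "full_sub B C \<Longrightarrow> hom B x y \<subseteq> hom C x y"
  and full_sub_obj: "full_sub B C \<Longrightarrow> x \<in> Obj B \<Longrightarrow> x \<in> Obj C"
  and full_sub_mor: "full_sub B C \<Longrightarrow> f \<in> Mor B \<Longrightarrow> f \<in> Mor C"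
  by (auto simp: full_sub_def hom_def)

lemma category_full_sub: "full_sub B C \<Longrightarrow> category C \<Longrightarrow> category B"
  unfolding full_sub_def category_def hom_def by auto

lemma functor_full_sub: "full_sub B C \<Longrightarrow> is_functor C E F \<Longrightarrow> is_functor B E F"
  unfolding full_sub_def is_functor_def by auto

lemma functor_into_full_sub: "full_sub B C \<Longrightarrow> is_functor A B F \<Longrightarrow> is_functor A C F"
  unfolding full_sub_def is_functor_def hom_def by auto

lemma functor_corestrict:
  assumes "full_sub B C" "category A" "is_functor A C F" "\<And>x. x \<in> Obj A \<Longrightarrow> fst F x \<in> Obj B"
  shows "is_functor A B F"
  using assms unfolding full_sub_def is_functor_def hom_def category_def by auto

lemma fun_eq_on_full_sub: "full_sub B C \<Longrightarrow> fun_eq_on C F G \<Longrightarrow> fun_eq_on B F G"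
  by (auto simp: fun_eq_on_def full_sub_def)

inductive_set comp_closure :: "('o, 'm) cat \<Rightarrow> 'm set \<Rightarrow> 'm set" for C S where
  generator: "f \<in> S \<Longrightarrow> f \<in> comp_closure C S"
| comp: "f \<in> comp_closure C S \<Longrightarrow> g \<in> comp_closure C S \<Longrightarrow> f \<in> hom C x y \<Longrightarrow> g \<in> hom C y z \<Longrightarrow>
    Comp C g f \<in> comp_closure C S"

lemma functor_comp_closure:
  assumes "f \<in> comp_closure C S" and F: "is_functor C B F"
    and S: "\<And>s. s \<in> S \<Longrightarrow> snd F s \<in> comp_closure B T"
  shows "snd F f \<in> comp_closure B T"
  using assms(1)
proof induction
  case (comp f g x y z)
  thus ?case
    using comp_closure.comp[OF comp.IH functor_hom[OF F] functor_hom[OF F]]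
    by (simp add: functor_comp[OF F])
qed (rule S)

lemma functor_eq_on_comp_closure:
  assumes "f \<in> comp_closure C S" and F: "is_functor C E F" and G: "is_functor C E G"
    and S: "\<And>s. s \<in> S \<Longrightarrow> snd F s = snd G s"
  shows "snd F f = snd G f"
  using assms(1) by induction (simp_all add: S functor_comp[OF F] functor_comp[OF G])

lemma natural_on_comp_closure:
  assumes f: "f \<in> comp_closure C S" "f \<in> Mor C" and C: "category C" and E: "category E"
    and F: "is_functor C E F" and G: "is_functor C E G"
    and \<tau>: "\<And>x. x \<in> Obj C \<Longrightarrow> \<tau> x \<in> hom E (fst F x) (fst G x)"
    and S: "\<And>s. s \<in> S \<Longrightarrow> Comp E (snd G s) (\<tau> (Dom C s)) = Comp E (\<tau> (Cod C s)) (snd F s)"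
  shows "Comp E (snd G f) (\<tau> (Dom C f)) = Comp E (\<tau> (Cod C f)) (snd F f)"
  using f
proof induction
  case (comp f g x y z)
  note f = \<open>f \<in> hom C x y\<close> and g = \<open>g \<in> hom C y z\<close>
  have x: "x \<in> Obj C" and y: "y \<in> Obj C" and z: "z \<in> Obj C"
    using category_dom[OF C f] category_dom[OF C g] category_cod[OF C g] .
  note Ff = functor_hom[OF F f] and Fg = functor_hom[OF F g]
    and Gf = functor_hom[OF G f] and Gg = functor_hom[OF G g]
  have nat_f: "Comp E (snd G f) (\<tau> x) = Comp E (\<tau> y) (snd F f)"
    and nat_g: "Comp E (snd G g) (\<tau> y) = Comp E (\<tau> z) (snd F g)"
    using comp.IH hom_memD[OF f] hom_memD[OF g] by simp_all
  have "Comp E (snd G (Comp C g f)) (\<tau> x) = Comp E (snd G g) (Comp E (snd G f) (\<tau> x))"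
    by (simp add: functor_comp[OF G f g] category_assoc[OF E \<tau>[OF x] Gf Gg])
  also have "\<dots> = Comp E (Comp E (snd G g) (\<tau> y)) (snd F f)"
    by (simp add: nat_f category_assoc[OF E Ff \<tau>[OF y] Gg])
  also have "\<dots> = Comp E (\<tau> z) (snd F (Comp C g f))"
    by (simp add: nat_g functor_comp[OF F f g] category_assoc[OF E Ff Fg \<tau>[OF z]])
  finally show ?case using hom_memD[OF category_comp[OF C f g]] by simp
qed (rule S)

section \<open>Retracts of categories\<close>

definition cat_retraction :: "('o, 'm) cat \<Rightarrow> ('o, 'm) cat \<Rightarrow> ('o, 'm, 'o, 'm) ftr \<Rightarrow> bool" where
  "cat_retraction C B P \<longleftrightarrow> full_sub B C \<and> is_functor C B P \<and> fun_eq_on B P (\<lambda>x. x, \<lambda>f. f)"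

lemma cat_retractionD:
  assumes "cat_retraction C B P"
  shows "full_sub B C" "is_functor C B P"
    "\<And>x. x \<in> Obj B \<Longrightarrow> fst P x = x" "\<And>f. f \<in> Mor B \<Longrightarrow> snd P f = f"
  using assms by (auto simp: cat_retraction_def fun_eq_on_def)

lemma cat_retraction_fun_eq_on:
  assumes "cat_retraction C B P"
  shows "fun_eq_on B (H \<circ>\<^sub>F P) H"
  using cat_retractionD(3,4)[OF assms] by (auto simp: fun_eq_on_def)

lemma fun_eq_on_restrict_retract:
  assumes "cat_retraction C B P" "fun_eq_on C F (H \<circ>\<^sub>F P)"
  shows "fun_eq_on B F H"
  using fun_eq_on_full_sub[OF cat_retractionD(1)[OF assms(1)] assms(2)]
    cat_retraction_fun_eq_on[OF assms(1)] by (rule fun_eq_on_trans)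

lemma fun_eq_on_extend_retract:
  assumes "is_functor C B P" "fun_eq_on C (Q \<circ>\<^sub>F G) (G \<circ>\<^sub>F P)" "fun_eq_on B (H \<circ>\<^sub>F G) K"
  shows "fun_eq_on C ((H \<circ>\<^sub>F Q) \<circ>\<^sub>F G) (K \<circ>\<^sub>F P)"
proof -
  have "fun_eq_on C ((H \<circ>\<^sub>F Q) \<circ>\<^sub>F G) ((H \<circ>\<^sub>F G) \<circ>\<^sub>F P)"
    unfolding fcomp_assoc by (rule fun_eq_on_fcomp_left[OF assms(2)])
  also have "fun_eq_on C \<dots> (K \<circ>\<^sub>F P)" by (rule fun_eq_on_fcomp_right[OF assms(1,3)])
  finally show ?thesis .
qed

lemma fun_eq_on_extend_retract_span:
  assumes P0: "is_functor C0 B0 P0" and H: "fun_eq_on B0 (H1 \<circ>\<^sub>F F1) (H2 \<circ>\<^sub>F F2)"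
    and PF: "fun_eq_on C0 (P1 \<circ>\<^sub>F F1) (F1 \<circ>\<^sub>F P0)" "fun_eq_on C0 (P2 \<circ>\<^sub>F F2) (F2 \<circ>\<^sub>F P0)"
  shows "fun_eq_on C0 ((H1 \<circ>\<^sub>F P1) \<circ>\<^sub>F F1) ((H2 \<circ>\<^sub>F P2) \<circ>\<^sub>F F2)"
  using fun_eq_on_extend_retract[OF P0 PF(1) H]
    fun_eq_on_sym[OF fun_eq_on_extend_retract[OF P0 PF(2) fun_eq_on_refl]]
  by (rule fun_eq_on_trans)

lemma functor_between_retracts:
  assumes C: "category C" and F: "is_functor C C' F"
    and P: "cat_retraction C B P" and P': "cat_retraction C' B' P'"
    and PF: "fun_eq_on C (P' \<circ>\<^sub>F F) (F \<circ>\<^sub>F P)"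
  shows "is_functor B B' F"
proof (rule functor_corestrict[OF cat_retractionD(1)[OF P']])
  note sub = cat_retractionD(1)[OF P]
  show "category B" using sub C by (rule category_full_sub)
  show "is_functor B C' F" using sub F by (rule functor_full_sub)
  show "fst F x \<in> Obj B'" if x: "x \<in> Obj B" for x
  proof -
    have xC: "x \<in> Obj C" using sub x by (rule full_sub_obj)
    have "fst F x = fst P' (fst F x)"
      using fun_eq_on_obj[OF PF xC] cat_retractionD(3)[OF P x] by simp
    thus ?thesis using functor_obj[OF cat_retractionD(2)[OF P'] functor_obj[OF F xC]] by simp
  qed
qed

text \<open>Naturality of the unit at a morphism of the subcategory says that \<open>P\<close> fixes it, because both
  components are identities.\<close>
lemma cat_retraction_of_unit:
  assumes C: "category C" and B: "full_sub B C" and P: "is_functor C B P"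
    and unit: "\<And>b. b \<in> Obj C \<Longrightarrow> \<eta> b \<in> hom C b (fst P b)"
    and natural: "\<And>f. f \<in> Mor C \<Longrightarrow> Comp C (snd P f) (\<eta> (Dom C f)) = Comp C (\<eta> (Cod C f)) f"
    and ident: "\<And>a. a \<in> Obj B \<Longrightarrow> \<eta> a = Id C a"
  shows "cat_retraction C B P"
proof -
  have P_obj: "fst P a = a" if a: "a \<in> Obj B" for a
    using unit[OF full_sub_obj[OF B a]] category_id[OF C full_sub_obj[OF B a]] ident[OF a]
    by (auto simp: hom_def)
  have "snd P f = f" if f: "f \<in> Mor B" for f
  proof -
    have f': "f \<in> hom C (Dom C f) (Cod C f)" "Dom C f \<in> Obj B" "Cod C f \<in> Obj B"
      using f B by (auto simp: full_sub_def hom_def)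
    have "snd P f \<in> hom C (Dom C f) (Cod C f)"
      using functor_hom[OF functor_into_full_sub[OF B P] f'(1)] P_obj f'(2,3) by simp
    hence "snd P f = Comp C (snd P f) (\<eta> (Dom C f))"
      using category_id_right[OF C] ident f'(2) by simp
    also have "\<dots> = Comp C (\<eta> (Cod C f)) f" using natural hom_memD[OF f'(1)] by blast
    also have "\<dots> = f" using category_id_left[OF C f'(1)] ident f'(3) by simp
    finally show ?thesis .
  qed
  thus ?thesis using B P P_obj by (simp add: cat_retraction_def fun_eq_on_def)
qed

lemma future_retractD:
  assumes "future_retract C B P \<eta>"
  shows "is_functor C B P" "\<And>b. b \<in> Obj C \<Longrightarrow> \<eta> b \<in> hom C b (fst P b)"
    "\<And>f. f \<in> Mor C \<Longrightarrow> Comp C (snd P f) (\<eta> (Dom C f)) = Comp C (\<eta> (Cod C f)) f"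
    "\<And>a b f. b \<in> Obj C \<Longrightarrow> a \<in> Obj B \<Longrightarrow> f \<in> hom C b a \<Longrightarrow> \<exists>!g. g \<in> hom B (fst P b) a \<and> Comp C g (\<eta> b) = f"
    "\<And>a. a \<in> Obj B \<Longrightarrow> \<eta> a = Id C a"
  using assms by (auto simp: future_retract_def)

lemma future_retract_cat_retraction:
  assumes "category C" "full_sub B C" "future_retract C B P \<eta>"
  shows "cat_retraction C B P"
  using assms(1,2) future_retractD(1,2,3,5)[OF assms(3)] by (rule cat_retraction_of_unit)

lemma future_retract_unit:
  assumes C: "category C" and B: "full_sub B C" and P: "future_retract C B P \<eta>" and b: "b \<in> Obj C"
  shows "snd P (\<eta> b) = Id C (fst P b)"
proof -
  note retr = cat_retractionD[OF future_retract_cat_retraction[OF C B P]]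
  note \<eta>_b = future_retractD(2)[OF P b]
  have Pb: "fst P b \<in> Obj B" by (rule functor_obj[OF retr(2) b])
  have "Comp C (snd P (\<eta> b)) (\<eta> b) = Comp C (\<eta> (fst P b)) (\<eta> b)"
    using future_retractD(3)[OF P, of "\<eta> b"] hom_memD[OF \<eta>_b] by simp
  also have "\<dots> = \<eta> b"
    using future_retractD(5)[OF P Pb] category_id_left[OF C \<eta>_b] by simp
  finally have "Comp C (snd P (\<eta> b)) (\<eta> b) = \<eta> b" .
  moreover have "Comp C (Id C (fst P b)) (\<eta> b) = \<eta> b" by (rule category_id_left[OF C \<eta>_b])
  moreover have "snd P (\<eta> b) \<in> hom B (fst P b) (fst P b)"
    using functor_hom[OF retr(2) \<eta>_b] retr(3)[OF Pb] by simp
  moreover have "Id C (fst P b) \<in> hom B (fst P b) (fst P b)"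
    using category_id[OF C full_sub_obj[OF B Pb]] full_sub_hom[OF B Pb Pb] by simp
  ultimately show ?thesis
    using future_retractD(4)[OF P b Pb \<eta>_b] by blast
qed

lemma future_retractI:
  assumes C: "category C" and B: "full_sub B C" and P: "is_functor C B P"
    and unit: "\<And>b. b \<in> Obj C \<Longrightarrow> \<eta> b \<in> hom C b (fst P b)"
    and natural: "\<And>f. f \<in> Mor C \<Longrightarrow> Comp C (snd P f) (\<eta> (Dom C f)) = Comp C (\<eta> (Cod C f)) f"
    and ident: "\<And>a. a \<in> Obj B \<Longrightarrow> \<eta> a = Id C a"
    and P_unit: "\<And>b. b \<in> Obj C \<Longrightarrow> snd P (\<eta> b) = Id C (fst P b)"
  shows "future_retract C B P \<eta>"
proof -
  have "cat_retraction C B P" using C B P unit natural ident by (rule cat_retraction_of_unit)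
  note retr = cat_retractionD[OF this]
  have "\<exists>!g. g \<in> hom B (fst P b) a \<and> Comp C g (\<eta> b) = f"
    if b: "b \<in> Obj C" and a: "a \<in> Obj B" and f: "f \<in> hom C b a" for a b f
  proof (rule ex1I[of _ "snd P f"], intro conjI)
    show "snd P f \<in> hom B (fst P b) a" using functor_hom[OF P f] retr(3)[OF a] by simp
    show "Comp C (snd P f) (\<eta> b) = f"
      using natural[of f] ident[OF a] category_id_left[OF C f] hom_memD[OF f] by simp
    fix g assume g: "g \<in> hom B (fst P b) a \<and> Comp C g (\<eta> b) = f"
    hence g_C: "g \<in> hom C (fst P b) a" using full_sub_hom_subset[OF B] by auto
    have "snd P f = Comp B (snd P g) (snd P (\<eta> b))"
      using functor_comp[OF P unit[OF b] g_C] g by simp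
    also have "\<dots> = Comp C g (Id C (fst P b))"
      using retr(4)[of g] g hom_memD P_unit[OF b] B by (fastforce simp: full_sub_def)
    also have "\<dots> = g" by (rule category_id_right[OF C g_C])
    finally show "g = snd P f" by simp
  qed
  thus ?thesis using P unit natural ident by (simp add: future_retract_def)
qed

definition opcat :: "('o, 'm) cat \<Rightarrow> ('o, 'm) cat" where
  "opcat C =
     \<lparr>Obj = Obj C, Mor = Mor C, Dom = Cod C, Cod = Dom C, Id = Id C, Comp = (\<lambda>g f. Comp C f g)\<rparr>"

lemma opcat_simps [simp]:
  "Obj (opcat C) = Obj C" "Mor (opcat C) = Mor C" "Dom (opcat C) = Cod C" "Cod (opcat C) = Dom C"
  "Id (opcat C) = Id C" "Comp (opcat C) g f = Comp C f g" "hom (opcat C) x y = hom C y x"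
  by (auto simp: opcat_def hom_def)

lemma category_opcat: "category C \<Longrightarrow> category (opcat C)"
  unfolding category_def by auto

lemma functor_opcat: "is_functor C E F \<Longrightarrow> is_functor (opcat C) (opcat E) F"
  unfolding is_functor_def by auto

lemma full_sub_opcat: "full_sub B C \<Longrightarrow> full_sub (opcat B) (opcat C)"
  unfolding full_sub_def opcat_def by auto

lemma comp_closure_opcat: "f \<in> comp_closure C S \<Longrightarrow> f \<in> comp_closure (opcat C) S"
proof (induction rule: comp_closure.induct)
  case (comp f g x y z)
  thus ?case using comp_closure.comp[of g "opcat C" S f z y x] by simp
qed (rule generator)

lemma future_retract_opcat_iff: "future_retract (opcat C) (opcat B) P \<eta> \<longleftrightarrow> past_retract C B P \<eta>"
  unfolding future_retract_def past_retract_def is_functor_def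
  by (auto; metis)

lemma retract_functor: "retract fut C B P \<eta> \<Longrightarrow> is_functor C B P"
  and retract_unit_mor: "retract fut C B P \<eta> \<Longrightarrow> x \<in> Obj C \<Longrightarrow> \<eta> x \<in> Mor C"
  by (auto simp: retract_def future_retract_def past_retract_def hom_def split: if_splits)

lemma retract_cat_retraction:
  assumes "category C" "full_sub B C" "retract fut C B P \<eta>"
  shows "cat_retraction C B P"
proof (cases fut)
  case True
  thus ?thesis using assms by (auto simp: retract_def intro: future_retract_cat_retraction)
next
  case False
  hence "future_retract (opcat C) (opcat B) P \<eta>"
    using assms(3) by (simp add: future_retract_opcat_iff retract_def)
  from future_retract_cat_retraction[OF category_opcat full_sub_opcat this] assms(1,2)
  have "cat_retraction (opcat C) (opcat B) P" by blast
  thus ?thesis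
    using assms(2) retract_functor[OF assms(3)] by (simp add: cat_retraction_def fun_eq_on_def)
qed

section \<open>Gluing retracts\<close>

definition glue_fun :: "'k set \<Rightarrow> ('k \<Rightarrow> 'a set) \<Rightarrow> ('k \<Rightarrow> 'a \<Rightarrow> 'b) \<Rightarrow> 'a \<Rightarrow> 'b" where
  "glue_fun K A f x = f (SOME k. k \<in> K \<and> x \<in> A k) x"

lemma glue_fun_eq:
  assumes "k \<in> K" "x \<in> A k"
    and agree: "\<And>k'. k' \<in> K \<Longrightarrow> x \<in> A k' \<Longrightarrow> f k' x = f k x"
  shows "glue_fun K A f x = f k x"
proof -
  have "\<exists>k. k \<in> K \<and> x \<in> A k" using assms(1,2) by blast
  from someI_ex[OF this] show ?thesis unfolding glue_fun_def using agree by blast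
qed

locale retract_cocone =
  fixes K :: "'k set" and Ck Bk :: "'k \<Rightarrow> ('o, 'm) cat" and C B :: "('o, 'm) cat"
    and G P :: "'k \<Rightarrow> ('o, 'm, 'o, 'm) ftr" and Q :: "('o, 'm, 'o, 'm) ftr"
  assumes category_C: "category C" and category_Ck: "\<And>k. k \<in> K \<Longrightarrow> category (Ck k)"
    and full_sub_B: "full_sub B C" and full_sub_Bk: "\<And>k. k \<in> K \<Longrightarrow> full_sub (Bk k) (Ck k)"
    and functor_G: "\<And>k. k \<in> K \<Longrightarrow> is_functor (Ck k) C (G k)"
    and G_obj: "\<And>k x. k \<in> K \<Longrightarrow> x \<in> Obj (Ck k) \<Longrightarrow> fst (G k) x = x"
    and Obj_C: "Obj C = (\<Union>k\<in>K. Obj (Ck k))" and Obj_B: "Obj B = (\<Union>k\<in>K. Obj (Bk k))"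
    and generated_C: "Mor C \<subseteq> comp_closure C (\<Union>k\<in>K. snd (G k) ` Mor (Ck k))"
    and functor_P: "\<And>k. k \<in> K \<Longrightarrow> is_functor (Ck k) (Bk k) (P k)"
    and functor_Q: "is_functor C B Q"
    and Q_G: "\<And>k. k \<in> K \<Longrightarrow> fun_eq_on (Ck k) (Q \<circ>\<^sub>F G k) (G k \<circ>\<^sub>F P k)"
begin

lemma generated_B:
  assumes "cat_retraction C B Q"
  shows "Mor B \<subseteq> comp_closure B (\<Union>k\<in>K. snd (G k) ` Mor (Bk k))" (is "_ \<subseteq> ?cl")
proof
  fix f assume f: "f \<in> Mor B"
  have "snd Q f \<in> ?cl"
  proof (rule functor_comp_closure[OF _ functor_Q])
    show "f \<in> comp_closure C (\<Union>k\<in>K. snd (G k) ` Mor (Ck k))"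
      using generated_C full_sub_mor[OF full_sub_B f] by blast
    fix s assume "s \<in> (\<Union>k\<in>K. snd (G k) ` Mor (Ck k))"
    then obtain k h where k: "k \<in> K" and h: "h \<in> Mor (Ck k)" "s = snd (G k) h" by auto
    have "snd Q s = snd (G k) (snd (P k) h)" using fun_eq_on_mor[OF Q_G[OF k] h(1)] h(2) by simp
    thus "snd Q s \<in> ?cl" using functor_mor[OF functor_P[OF k] h(1)] k by (auto intro!: generator)
  qed
  thus "f \<in> ?cl" using cat_retractionD(4)[OF assms f] by simp
qed

lemma P_obj: "k \<in> K \<Longrightarrow> x \<in> Obj (Ck k) \<Longrightarrow> fst (P k) x \<in> Obj (Ck k)"
  by (rule full_sub_obj[OF full_sub_Bk functor_obj[OF functor_P]])

lemma Q_obj: "k \<in> K \<Longrightarrow> x \<in> Obj (Ck k) \<Longrightarrow> fst Q x = fst (P k) x"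
  using fun_eq_on_obj[OF Q_G] G_obj P_obj by simp

lemma retract_cocone_opcat:
  "retract_cocone K (\<lambda>k. opcat (Ck k)) (\<lambda>k. opcat (Bk k)) (opcat C) (opcat B) G P Q"
proof
  show "Mor (opcat C) \<subseteq> comp_closure (opcat C) (\<Union>k\<in>K. snd (G k) ` Mor (opcat (Ck k)))"
    using generated_C by (auto intro: comp_closure_opcat)
qed (use category_C category_Ck full_sub_B full_sub_Bk functor_G G_obj Obj_C Obj_B
      functor_P functor_Q Q_G in
    \<open>auto intro: category_opcat functor_opcat full_sub_opcat simp: fun_eq_on_def\<close>)

end

locale future_retract_cocone = retract_cocone K Ck Bk C B G P Q
  for K :: "'k set" and Ck Bk :: "'k \<Rightarrow> ('o, 'm) cat" and C B G P Q +
  fixes \<eta> :: "'k \<Rightarrow> 'o \<Rightarrow> 'm"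
  assumes future_retract_P: "\<And>k. k \<in> K \<Longrightarrow> future_retract (Ck k) (Bk k) (P k) (\<eta> k)"
    and \<eta>_agree: "\<And>k k' x. k \<in> K \<Longrightarrow> k' \<in> K \<Longrightarrow> x \<in> Obj (Ck k) \<Longrightarrow> x \<in> Obj (Ck k') \<Longrightarrow>
       snd (G k) (\<eta> k x) = snd (G k') (\<eta> k' x)"
begin

definition glued_unit :: "'o \<Rightarrow> 'm" where
  "glued_unit = glue_fun K (\<lambda>k. Obj (Ck k)) (\<lambda>k x. snd (G k) (\<eta> k x))"

lemma glued_unit_eq: "k \<in> K \<Longrightarrow> x \<in> Obj (Ck k) \<Longrightarrow> glued_unit x = snd (G k) (\<eta> k x)"
  unfolding glued_unit_def by (rule glue_fun_eq) (assumption | rule \<eta>_agree)+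

lemma \<eta>_hom: "k \<in> K \<Longrightarrow> x \<in> Obj (Ck k) \<Longrightarrow> \<eta> k x \<in> hom (Ck k) x (fst (P k) x)"
  by (rule future_retractD(2)[OF future_retract_P])

lemma glued_unit_hom:
  assumes "x \<in> Obj C"
  shows "glued_unit x \<in> hom C x (fst Q x)"
proof -
  obtain k where k: "k \<in> K" "x \<in> Obj (Ck k)" using assms Obj_C by auto
  show ?thesis
    using functor_hom[OF functor_G \<eta>_hom] k G_obj P_obj Q_obj glued_unit_eq by metis
qed

lemma glued_unit_natural_generator:
  assumes k: "k \<in> K" and h: "h \<in> Mor (Ck k)"
  shows "Comp C (snd Q (snd (G k) h)) (glued_unit (Dom C (snd (G k) h))) =
    Comp C (glued_unit (Cod C (snd (G k) h))) (snd (G k) h)"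
proof -
  let ?x = "Dom (Ck k) h" and ?y = "Cod (Ck k) h"
  note h_hom = Mor_in_hom[OF h]
  have x: "?x \<in> Obj (Ck k)" and y: "?y \<in> Obj (Ck k)"
    using category_dom[OF category_Ck[OF k] h_hom] category_cod[OF category_Ck[OF k] h_hom] .
  have ends: "Dom C (snd (G k) h) = ?x" "Cod C (snd (G k) h) = ?y"
    using hom_memD[OF functor_hom[OF functor_G[OF k] h_hom]] G_obj[OF k] x y by auto
  have Ph: "snd (P k) h \<in> hom (Ck k) (fst (P k) ?x) (fst (P k) ?y)"
    by (rule functor_hom[OF functor_into_full_sub[OF full_sub_Bk[OF k] functor_P[OF k]] h_hom])
  have "Comp C (snd Q (snd (G k) h)) (glued_unit ?x) = snd (G k) (Comp (Ck k) (snd (P k) h) (\<eta> k ?x))"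
    using fun_eq_on_mor[OF Q_G[OF k] h] glued_unit_eq[OF k x]
      functor_comp[OF functor_G[OF k] \<eta>_hom[OF k x] Ph] by simp
  also have "\<dots> = snd (G k) (Comp (Ck k) (\<eta> k ?y) h)"
    by (simp add: future_retractD(3)[OF future_retract_P[OF k] h])
  also have "\<dots> = Comp C (glued_unit ?y) (snd (G k) h)"
    using functor_comp[OF functor_G[OF k] h_hom \<eta>_hom[OF k y]] glued_unit_eq[OF k y] by simp
  finally show ?thesis unfolding ends .
qed

lemma glued_unit_natural:
  assumes f: "f \<in> Mor C"
  shows "Comp C (snd Q f) (glued_unit (Dom C f)) = Comp C (glued_unit (Cod C f)) f"
proof -
  have "f \<in> comp_closure C (\<Union>k\<in>K. snd (G k) ` Mor (Ck k))" using f generated_C by blast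
  from natural_on_comp_closure[OF this f category_C category_C functor_ident
      functor_into_full_sub[OF full_sub_B functor_Q], of glued_unit]
  show ?thesis using glued_unit_hom glued_unit_natural_generator by fastforce
qed

lemma glued_unit_ident:
  assumes "a \<in> Obj B"
  shows "glued_unit a = Id C a"
proof -
  obtain k where k: "k \<in> K" and a: "a \<in> Obj (Bk k)" using assms Obj_B by auto
  have a': "a \<in> Obj (Ck k)" using full_sub_obj[OF full_sub_Bk[OF k] a] .
  show ?thesis
    using glued_unit_eq[OF k a'] future_retractD(5)[OF future_retract_P[OF k] a]
      functor_id[OF functor_G[OF k] a'] G_obj[OF k a'] by simp
qed

lemma Q_glued_unit:
  assumes "x \<in> Obj C"
  shows "snd Q (glued_unit x) = Id C (fst Q x)"
proof -
  obtain k where k: "k \<in> K" and x: "x \<in> Obj (Ck k)" using assms Obj_C by auto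
  have "snd Q (glued_unit x) = snd (G k) (snd (P k) (\<eta> k x))"
    using fun_eq_on_mor[OF Q_G[OF k]] glued_unit_eq[OF k x] hom_memD[OF \<eta>_hom[OF k x]] by simp
  also have "\<dots> = snd (G k) (Id (Ck k) (fst (P k) x))"
    using future_retract_unit[OF category_Ck full_sub_Bk future_retract_P x] k by simp
  also have "\<dots> = Id C (fst Q x)"
    using functor_id[OF functor_G[OF k] P_obj[OF k x]] G_obj[OF k P_obj[OF k x]] Q_obj[OF k x] by simp
  finally show ?thesis .
qed

lemma future_retract_glued: "future_retract C B Q glued_unit"
  using category_C full_sub_B functor_Q
    glued_unit_hom glued_unit_natural glued_unit_ident Q_glued_unit
  by (rule future_retractI)

end

lemma (in retract_cocone) retract_glued:
  assumes P: "\<And>k. k \<in> K \<Longrightarrow> retract fut (Ck k) (Bk k) (P k) (\<eta> k)"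
    and agree: "\<And>k k' x. k \<in> K \<Longrightarrow> k' \<in> K \<Longrightarrow> x \<in> Obj (Ck k) \<Longrightarrow> x \<in> Obj (Ck k') \<Longrightarrow>
       snd (G k) (\<eta> k x) = snd (G k') (\<eta> k' x)"
  shows "\<exists>v. retract fut C B Q v"
proof (cases fut)
  case True
  interpret future_retract_cocone K Ck Bk C B G P Q \<eta>
  proof
    show "future_retract (Ck k) (Bk k) (P k) (\<eta> k)" if "k \<in> K" for k
      using P[OF that] True by (simp add: retract_def)
  qed (rule agree)
  show ?thesis using future_retract_glued True by (auto simp: retract_def)
next
  case False
  interpret op: retract_cocone K "\<lambda>k. opcat (Ck k)" "\<lambda>k. opcat (Bk k)" "opcat C" "opcat B" G P Q
    by (rule retract_cocone_opcat)
  interpret op: future_retract_cocone K "\<lambda>k. opcat (Ck k)" "\<lambda>k. opcat (Bk k)"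
    "opcat C" "opcat B" G P Q \<eta>
  proof
    show "future_retract (opcat (Ck k)) (opcat (Bk k)) (P k) (\<eta> k)" if "k \<in> K" for k
      using P[OF that] False by (simp add: retract_def future_retract_opcat_iff)
  qed (unfold opcat_simps, rule agree)
  show ?thesis
    using op.future_retract_glued False by (auto simp: retract_def future_retract_opcat_iff)
qed

section \<open>Retracts of pushouts\<close>

definition mediates :: "('o1, 'm1) cat \<Rightarrow> ('o2, 'm2) cat \<Rightarrow> ('o, 'm) cat \<Rightarrow> ('oe, 'me) cat \<Rightarrow>
    ('o1, 'm1, 'o, 'm) ftr \<Rightarrow> ('o2, 'm2, 'o, 'm) ftr \<Rightarrow>
    ('o1, 'm1, 'oe, 'me) ftr \<Rightarrow> ('o2, 'm2, 'oe, 'me) ftr \<Rightarrow>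
    ('o, 'm, 'oe, 'me) ftr \<Rightarrow> bool" where
  "mediates C1 C2 C E G1 G2 H1 H2 H \<longleftrightarrow>
     is_functor C E H \<and> fun_eq_on C1 (H \<circ>\<^sub>F G1) H1 \<and> fun_eq_on C2 (H \<circ>\<^sub>F G2) H2"

lemma is_pushoutD:
  assumes "is_pushout T C0 C1 C2 C F1 F2 G1 G2"
  shows "category C0" "category C1" "category C2" "category C"
    "is_functor C0 C1 F1" "is_functor C0 C2 F2" "is_functor C1 C G1" "is_functor C2 C G2"
    "fun_eq_on C0 (G1 \<circ>\<^sub>F F1) (G2 \<circ>\<^sub>F F2)"
  using assms by (simp_all add: is_pushout_def)

lemma is_pushoutE:
  fixes E :: "('oe, 'me) cat"
  assumes "is_pushout TYPE(('oe, 'me) cat) C0 C1 C2 C F1 F2 G1 G2" "category E"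
    "is_functor C1 E H1" "is_functor C2 E H2" "fun_eq_on C0 (H1 \<circ>\<^sub>F F1) (H2 \<circ>\<^sub>F F2)"
  obtains H where "mediates C1 C2 C E G1 G2 H1 H2 H"
    "\<forall>H'. mediates C1 C2 C E G1 G2 H1 H2 H' \<longrightarrow> fun_eq_on C H H'"
proof -
  have "\<exists>H. mediates C1 C2 C E G1 G2 H1 H2 H \<and>
      (\<forall>H'. mediates C1 C2 C E G1 G2 H1 H2 H' \<longrightarrow> fun_eq_on C H H')"
    using assms(1)[unfolded is_pushout_def] assms(2-)
    by (simp add: mediates_def conj_assoc del: split_paired_All split_paired_Ex)
  thus ?thesis using that by blast
qed

lemma is_pushoutI:
  assumes "category C0" "category C1" "category C2" "category C"
    and "is_functor C0 C1 F1" "is_functor C0 C2 F2" "is_functor C1 C G1" "is_functor C2 C G2"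
    and "fun_eq_on C0 (G1 \<circ>\<^sub>F F1) (G2 \<circ>\<^sub>F F2)"
    and "\<And>(E :: ('oe, 'me) cat) H1 H2. category E \<Longrightarrow> is_functor C1 E H1 \<Longrightarrow> is_functor C2 E H2 \<Longrightarrow>
      fun_eq_on C0 (H1 \<circ>\<^sub>F F1) (H2 \<circ>\<^sub>F F2) \<Longrightarrow>
      \<exists>H. mediates C1 C2 C E G1 G2 H1 H2 H \<and>
        (\<forall>H'. mediates C1 C2 C E G1 G2 H1 H2 H' \<longrightarrow> fun_eq_on C H H')"
  shows "is_pushout TYPE(('oe, 'me) cat) C0 C1 C2 C F1 F2 G1 G2"
  unfolding is_pushout_def
proof (intro conjI allI impI assms(1-9))
  fix E :: "('oe, 'me) cat" and H1 H2
  assume "category E \<and> is_functor C1 E H1 \<and> is_functor C2 E H2 \<and> fun_eq_on C0 (H1 \<circ>\<^sub>F F1) (H2 \<circ>\<^sub>F F2)"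
  with assms(10)[of E H1 H2]
  show "\<exists>H. is_functor C E H \<and> fun_eq_on C1 (H \<circ>\<^sub>F G1) H1 \<and> fun_eq_on C2 (H \<circ>\<^sub>F G2) H2 \<and>
      (\<forall>H'. is_functor C E H' \<and> fun_eq_on C1 (H' \<circ>\<^sub>F G1) H1 \<and> fun_eq_on C2 (H' \<circ>\<^sub>F G2) H2 \<longrightarrow>
        fun_eq_on C H H')"
    unfolding mediates_def conj_assoc by blast
qed

lemma pushout_retraction_functor:
  fixes C B :: "('o, 'm) cat"
  assumes po: "is_pushout TYPE(('o, 'm) cat) C0 C1 C2 C F1 F2 G1 G2"
    and P: "cat_retraction C0 B0 P0" "is_functor C1 B1 P1" "is_functor C2 B2 P2"
    and PF: "fun_eq_on C0 (P1 \<circ>\<^sub>F F1) (F1 \<circ>\<^sub>F P0)" "fun_eq_on C0 (P2 \<circ>\<^sub>F F2) (F2 \<circ>\<^sub>F P0)"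
    and B: "full_sub B C" and G: "is_functor B1 B G1" "is_functor B2 B G2"
  obtains Q where "mediates C1 C2 C B G1 G2 (G1 \<circ>\<^sub>F P1) (G2 \<circ>\<^sub>F P2) Q"
    "\<forall>Q'. mediates C1 C2 C B G1 G2 (G1 \<circ>\<^sub>F P1) (G2 \<circ>\<^sub>F P2) Q' \<longrightarrow> fun_eq_on C Q Q'"
proof -
  have "fun_eq_on B0 (G1 \<circ>\<^sub>F F1) (G2 \<circ>\<^sub>F F2)"
    by (rule fun_eq_on_full_sub[OF cat_retractionD(1)[OF P(1)] is_pushoutD(9)[OF po]])
  hence "fun_eq_on C0 ((G1 \<circ>\<^sub>F P1) \<circ>\<^sub>F F1) ((G2 \<circ>\<^sub>F P2) \<circ>\<^sub>F F2)"
    by (rule fun_eq_on_extend_retract_span[OF cat_retractionD(2)[OF P(1)] _ PF])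
  with category_full_sub[OF B is_pushoutD(4)[OF po]]
    functor_fcomp[OF P(2) G(1)] functor_fcomp[OF P(3) G(2)]
  show thesis using that by (rule is_pushoutE[OF po])
qed

lemma mediates_restrict_retract:
  assumes P1: "cat_retraction C1 B1 P1" and P2: "cat_retraction C2 B2 P2" and B: "full_sub B C"
    and H: "mediates C1 C2 C E G1 G2 (H1 \<circ>\<^sub>F P1) (H2 \<circ>\<^sub>F P2) H"
  shows "mediates B1 B2 B E G1 G2 H1 H2 H"
  using H functor_full_sub[OF B] fun_eq_on_restrict_retract[OF P1] fun_eq_on_restrict_retract[OF P2]
  unfolding mediates_def by blast

lemma mediates_extend_retract:
  assumes "is_functor C1 B1 P1" "is_functor C2 B2 P2" "is_functor C B Q"
    and "fun_eq_on C1 (Q \<circ>\<^sub>F G1) (G1 \<circ>\<^sub>F P1)" "fun_eq_on C2 (Q \<circ>\<^sub>F G2) (G2 \<circ>\<^sub>F P2)"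
    and "mediates B1 B2 B E G1 G2 H1 H2 H"
  shows "mediates C1 C2 C E G1 G2 (H1 \<circ>\<^sub>F P1) (H2 \<circ>\<^sub>F P2) (H \<circ>\<^sub>F Q)"
  using assms(6) functor_fcomp[OF assms(3)] fun_eq_on_extend_retract[OF assms(1,4)]
    fun_eq_on_extend_retract[OF assms(2,5)] unfolding mediates_def by blast

lemma pushout_retract:
  assumes po: "is_pushout TYPE(('oe, 'me) cat) C0 C1 C2 C F1 F2 G1 G2"
    and P0: "cat_retraction C0 B0 P0" and P1: "cat_retraction C1 B1 P1"
    and P2: "cat_retraction C2 B2 P2" and Q: "cat_retraction C B Q"
    and PF: "fun_eq_on C0 (P1 \<circ>\<^sub>F F1) (F1 \<circ>\<^sub>F P0)" "fun_eq_on C0 (P2 \<circ>\<^sub>F F2) (F2 \<circ>\<^sub>F P0)"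
    and QG: "fun_eq_on C1 (Q \<circ>\<^sub>F G1) (G1 \<circ>\<^sub>F P1)" "fun_eq_on C2 (Q \<circ>\<^sub>F G2) (G2 \<circ>\<^sub>F P2)"
  shows "is_pushout TYPE(('oe, 'me) cat) B0 B1 B2 B F1 F2 G1 G2"
proof (rule is_pushoutI)
  note square = is_pushoutD[OF po]
  note functors = cat_retractionD(2)[OF P1] cat_retractionD(2)[OF P2] cat_retractionD(2)[OF Q]
  show "category B0" "category B1" "category B2" "category B"
    using P0 P1 P2 Q square(1-4) by (auto dest: cat_retractionD(1) intro: category_full_sub)
  show "is_functor B0 B1 F1" "is_functor B0 B2 F2" "is_functor B1 B G1" "is_functor B2 B G2"
    using functor_between_retracts[OF square(1,5) P0 P1 PF(1)]
      functor_between_retracts[OF square(1,6) P0 P2 PF(2)]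
      functor_between_retracts[OF square(2,7) P1 Q QG(1)]
      functor_between_retracts[OF square(3,8) P2 Q QG(2)] .
  show "fun_eq_on B0 (G1 \<circ>\<^sub>F F1) (G2 \<circ>\<^sub>F F2)"
    by (rule fun_eq_on_full_sub[OF cat_retractionD(1)[OF P0] square(9)])
  fix E :: "('oe, 'me) cat" and H1 H2
  assume E: "category E" and H1: "is_functor B1 E H1" and H2: "is_functor B2 E H2"
    and "fun_eq_on B0 (H1 \<circ>\<^sub>F F1) (H2 \<circ>\<^sub>F F2)"
  hence "fun_eq_on C0 ((H1 \<circ>\<^sub>F P1) \<circ>\<^sub>F F1) ((H2 \<circ>\<^sub>F P2) \<circ>\<^sub>F F2)"
    by (intro fun_eq_on_extend_retract_span[OF cat_retractionD(2)[OF P0] _ PF])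
  with E functor_fcomp[OF functors(1) H1] functor_fcomp[OF functors(2) H2]
  obtain H where H: "mediates C1 C2 C E G1 G2 (H1 \<circ>\<^sub>F P1) (H2 \<circ>\<^sub>F P2) H"
    and unique: "\<forall>H'. mediates C1 C2 C E G1 G2 (H1 \<circ>\<^sub>F P1) (H2 \<circ>\<^sub>F P2) H' \<longrightarrow> fun_eq_on C H H'"
    by (rule is_pushoutE[OF po])
  have "fun_eq_on B H H'" if "mediates B1 B2 B E G1 G2 H1 H2 H'" for H'
    using unique mediates_extend_retract[OF functors QG that] fun_eq_on_restrict_retract[OF Q]
    by blast
  thus "\<exists>H. mediates B1 B2 B E G1 G2 H1 H2 H \<and>
      (\<forall>H'. mediates B1 B2 B E G1 G2 H1 H2 H' \<longrightarrow> fun_eq_on B H H')"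
    using mediates_restrict_retract[OF P1 P2 cat_retractionD(1)[OF Q] H] by blast
qed

section \<open>Fundamental categories\<close>

definition path_mor :: "(real \<Rightarrow> 'a::topological_space) set \<Rightarrow> 'a set \<Rightarrow> (real \<Rightarrow> 'a) \<Rightarrow> 'a dmor" where
  "path_mor D Y p = (p 0, p 1, dclass Y (dsub D Y) p)"

lemma path_mor_endpoints [simp]: "fst (path_mor D Y p) = p 0" "fst (snd (path_mor D Y p)) = p 1"
  by (simp_all add: path_mor_def)

lemma fc_simps [simp]:
  "Obj (fc D Y A) = A" "Dom (fc D Y A) f = fst f" "Cod (fc D Y A) f = fst (snd f)"
  "Id (fc D Y A) a = path_mor D Y (\<lambda>t. a)"
  by (simp_all add: fc_def fund_cat_def path_mor_def)

lemma Mor_fc: "Mor (fc D Y A) = {path_mor D Y p |p. p \<in> dsub D Y \<and> p 0 \<in> A \<and> p 1 \<in> A}"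
  by (auto simp: fc_def fund_cat_def path_mor_def)

lemma Mor_fcE:
  assumes "f \<in> Mor (fc D Y A)"
  obtains p where "f = path_mor D Y p" "p \<in> dsub D Y" "p 0 \<in> A" "p 1 \<in> A"
  using assms by (auto simp: Mor_fc)

lemma path_mor_in_Mor: "p \<in> dsub D Y \<Longrightarrow> p 0 \<in> A \<Longrightarrow> p 1 \<in> A \<Longrightarrow> path_mor D Y p \<in> Mor (fc D Y A)"
  by (auto simp: Mor_fc)

lemma path_mor_in_hom:
  "p \<in> dsub D Y \<Longrightarrow> p 0 \<in> A \<Longrightarrow> p 1 \<in> A \<Longrightarrow> path_mor D Y p \<in> hom (fc D Y A) (p 0) (p 1)"
  by (auto simp: Mor_fc hom_def)

lemma path_mor_hom:
  "d_space Y (dsub D Y) \<Longrightarrow> p \<in> dsub D Y \<Longrightarrow> path_mor D Y p \<in> hom (fc D Y Y) (p 0) (p 1)"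
  by (intro path_mor_in_hom d_space_endpoints[of Y "dsub D Y"])

lemma path_mor_cong: "(p, q) \<in> direl Y (dsub D Y) \<Longrightarrow> path_mor D Y p = path_mor D Y q"
  by (simp add: path_mor_def dclass_eqI direl_endpoints)

lemma Comp_path_mor:
  assumes "d_space Y (dsub D Y)" "p \<in> dsub D Y" "q \<in> dsub D Y" "p 1 = q 0"
  shows "Comp (fc D Y A) (path_mor D Y q) (path_mor D Y p) = path_mor D Y (p +++ q)"
proof -
  have "(p +++ q, rep (dclass Y (dsub D Y) p) +++ rep (dclass Y (dsub D Y) q)) \<in> direl Y (dsub D Y)"
    using assms by (intro direl_join rep_dclass)
  from dclass_eqI[OF this] show ?thesis by (simp add: fc_def fund_cat_def path_mor_def)
qed

lemma category_fc:
  assumes Y: "d_space Y (dsub D Y)" and A: "A \<subseteq> Y"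
  shows "category (fc D Y A)" (is "category ?C")
  unfolding category_def
proof (intro conjI ballI impI)
  note comp = Comp_path_mor[OF Y] and join = d_space_join[OF Y]
  fix f assume "f \<in> Mor ?C"
  then obtain p where p: "f = path_mor D Y p" "p \<in> dsub D Y" "p 0 \<in> A" "p 1 \<in> A" by (rule Mor_fcE)
  show "Dom ?C f \<in> Obj ?C" "Cod ?C f \<in> Obj ?C" using p by auto
  have "(\<lambda>t. p 0) \<in> dsub D Y" "(\<lambda>t. p 1) \<in> dsub D Y"
    using d_space_endpoints[OF Y p(2)] by (auto intro: d_space_const[OF Y])
  thus "Comp ?C f (Id ?C (Dom ?C f)) = f" "Comp ?C (Id ?C (Cod ?C f)) f = f"
    using p path_mor_cong[OF direl_join_const_left[OF Y p(2)], symmetric]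
      path_mor_cong[OF direl_join_const_right[OF Y p(2)], symmetric] by (simp_all add: comp)
  fix g assume "g \<in> Mor ?C"
  then obtain q where q: "g = path_mor D Y q" "q \<in> dsub D Y" "q 0 \<in> A" "q 1 \<in> A" by (rule Mor_fcE)
  show "Comp ?C g f \<in> hom ?C (Dom ?C f) (Cod ?C g)" if "Cod ?C f = Dom ?C g"
    using that p q path_mor_in_hom[of "p +++ q" D Y A] by (simp add: comp join)
  fix h assume "h \<in> Mor ?C"
  then obtain r where r: "h = path_mor D Y r" "r \<in> dsub D Y" by (auto simp: Mor_fc)
  show "Comp ?C h (Comp ?C g f) = Comp ?C (Comp ?C h g) f"
    if "Cod ?C f = Dom ?C g \<and> Cod ?C g = Dom ?C h"
    using that p q r direl_join_assoc[OF Y, of p q r] by (simp add: comp join path_mor_cong)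
next
  fix x assume "x \<in> Obj ?C"
  thus "Id ?C x \<in> hom ?C x x"
    using A path_mor_in_hom[of "\<lambda>t. x" D Y A] by (auto intro: d_space_const[OF Y])
qed

lemma full_sub_fc: "A \<subseteq> B \<Longrightarrow> full_sub (fc D Y A) (fc D Y B)"
  unfolding full_sub_def fc_def fund_cat_def by auto

lemma fst_incl [simp]: "fst (incl D Z) x = x"
  by (simp add: incl_def)

lemma incl_path_mor:
  assumes "Y \<subseteq> Z" "p \<in> dsub D Y"
  shows "snd (incl D Z) (path_mor D Y p) = path_mor D Z p"
proof -
  have "(p, rep (dclass Y (dsub D Y) p)) \<in> direl Z (dsub D Z)"
    using direl_d_map[OF d_map_dsub_inclusion[OF assms(1)] rep_dclass[OF assms(2)]]
    by (simp add: comp_def)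
  from dclass_eqI[OF this] show ?thesis by (simp add: incl_def path_mor_def)
qed

lemma functor_incl:
  assumes Y: "d_space Y (dsub D Y)" and Z: "d_space Z (dsub D Z)"
    and "Y \<subseteq> Z" and A: "A \<subseteq> Y" "A \<subseteq> B"
  shows "is_functor (fc D Y A) (fc D Z B) (incl D Z)" (is "is_functor ?C ?E ?I")
  unfolding is_functor_def
proof (intro conjI ballI impI)
  note incl = incl_path_mor[OF \<open>Y \<subseteq> Z\<close>] and sub = subsetD[OF dsub_mono[OF \<open>Y \<subseteq> Z\<close>]]
  fix f assume "f \<in> Mor ?C"
  then obtain p where p: "f = path_mor D Y p" "p \<in> dsub D Y" "p 0 \<in> A" "p 1 \<in> A" by (rule Mor_fcE)
  show "snd ?I f \<in> hom ?E (fst ?I (Dom ?C f)) (fst ?I (Cod ?C f))"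
    using p A path_mor_in_hom[OF sub[OF p(2)], of B] by (auto simp: incl)
  fix g assume "g \<in> Mor ?C"
  then obtain q where q: "g = path_mor D Y q" "q \<in> dsub D Y" by (auto simp: Mor_fc)
  show "snd ?I (Comp ?C g f) = Comp ?E (snd ?I g) (snd ?I f)" if "Cod ?C f = Dom ?C g"
    using that p q d_space_join[OF Y p(2) q(2)]
    by (simp add: incl sub Comp_path_mor[OF Y] Comp_path_mor[OF Z])
next
  fix x assume "x \<in> Obj ?C"
  thus "snd ?I (Id ?C x) = Id ?E (fst ?I x)"
    using A by (auto simp: incl_path_mor[OF \<open>Y \<subseteq> Z\<close>] d_space_const[OF Y])
qed (use A in auto)

lemma fun_eq_on_incl_incl:
  assumes "Y \<subseteq> Z" "Z \<subseteq> W"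
  shows "fun_eq_on (fc D Y A) (incl D W \<circ>\<^sub>F incl D Z) (incl D W)"
proof -
  have "snd (incl D W) (snd (incl D Z) f) = snd (incl D W) f" if f: "f \<in> Mor (fc D Y A)" for f
  proof -
    obtain p where p: "f = path_mor D Y p" "p \<in> dsub D Y" using f by (rule Mor_fcE)
    hence "p \<in> dsub D Z" using dsub_mono[OF assms(1)] by blast
    thus ?thesis using p assms by (simp add: incl_path_mor)
  qed
  thus ?thesis by (simp add: fun_eq_on_def)
qed

section \<open>Subdividing dipaths and directed squares\<close>

lemma Bolzano_within [consumes 1, case_names trans local]:
  fixes P :: "real \<Rightarrow> real \<Rightarrow> bool"
  assumes "a \<le> b"
    and trans: "\<And>c d e. a \<le> c \<Longrightarrow> c \<le> d \<Longrightarrow> d \<le> e \<Longrightarrow> e \<le> b \<Longrightarrow> P c d \<Longrightarrow> P d e \<Longrightarrow> P c e"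
    and local: "\<And>x. a \<le> x \<Longrightarrow> x \<le> b \<Longrightarrow>
      \<exists>\<delta>>0. \<forall>c d. a \<le> c \<and> c \<le> x \<and> x \<le> d \<and> d \<le> b \<and> d - c < \<delta> \<longrightarrow> P c d"
  shows "P a b"
proof -
  have "a \<le> a \<longrightarrow> b \<le> b \<longrightarrow> P a b"
    using assms(1)
  proof (induction rule: Bolzano[where P = "\<lambda>c d. a \<le> c \<longrightarrow> d \<le> b \<longrightarrow> P c d"])
    case (trans c d e)
    thus ?case using assms(2)[of c d e] by auto
  next
    case (local x)
    thus ?case using assms(3)[of x] by blast
  qed
  thus ?thesis by simp
qed

lemma d_square_edges:
  assumes H: "d_square X D H" and "c \<in> {0..1}"
  shows "(\<lambda>t. H (c, t)) \<in> D" "(\<lambda>s. H (s, c)) \<in> D"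
proof -
  have "(\<lambda>t. (c, t)) \<in> mono_paths unit_square" "(\<lambda>s. (s, c)) \<in> mono_paths unit_square"
    using assms(2) by (auto simp: mono_paths_def mono_on_def intro!: continuous_intros)
  from this[THEN d_mapD(3)[OF H]] show "(\<lambda>t. H (c, t)) \<in> D" "(\<lambda>s. H (s, c)) \<in> D"
    by (simp_all add: comp_def)
qed

lemma direl_rectangle_boundary:
  assumes H: "d_square X D H" and ab: "0 \<le> a" "a \<le> b" "b \<le> 1" and cd: "0 \<le> c" "c \<le> d" "d \<le> 1"
    and Y: "H ` ({a..b} \<times> {c..d}) \<subseteq> Y"
  shows "(subdipath c d (\<lambda>t. H (a, t)) +++ subdipath a b (\<lambda>s. H (s, d)),
    subdipath a b (\<lambda>s. H (s, c)) +++ subdipath c d (\<lambda>t. H (b, t))) \<in> direl Y (dsub D Y)"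
proof -
  let ?R = "{a..b} \<times> {c..d}"
  define vertical where "vertical x = (\<lambda>t. (x, linepath c d t))" for x :: real
  define horizontal where "horizontal y = (\<lambda>s. (linepath a b s, y))" for y :: real
  have vertical: "vertical x \<in> mono_paths ?R" if "x \<in> {a..b}" for x
    using that mono_pathsD[OF linepath_mono_path[OF order_refl cd(2) order_refl]]
    by (auto simp: vertical_def mono_paths_def intro!: mono_onI continuous_intros)
  have horizontal: "horizontal y \<in> mono_paths ?R" if "y \<in> {c..d}" for y
    using that mono_pathsD[OF linepath_mono_path[OF order_refl ab(2) order_refl]]
    by (auto simp: horizontal_def mono_paths_def intro!: mono_onI continuous_intros)
  have ends: "vertical x 0 = (x, c)" "vertical x 1 = (x, d)"
    "horizontal y 0 = (a, y)" "horizontal y 1 = (b, y)" for x y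
    by (simp_all add: vertical_def horizontal_def linepath_0' linepath_1')
  have "vertical a +++ horizontal d \<in> mono_paths ?R" "horizontal c +++ vertical b \<in> mono_paths ?R"
    using ab cd by (auto intro!: d_space_join[OF d_space_mono_paths] vertical horizontal simp: ends)
  hence "(vertical a +++ horizontal d, horizontal c +++ vertical b) \<in> direl ?R (mono_paths ?R)"
    unfolding Times_interval_eq by (rule direl_mono_paths) (simp_all add: ends)
  moreover have "d_map ?R (mono_paths ?R) Y (dsub D Y) H"
    using ab cd Y by (intro d_map_restrict[OF H]) auto
  ultimately
  have "(H \<circ> (vertical a +++ horizontal d), H \<circ> (horizontal c +++ vertical b)) \<in> direl Y (dsub D Y)"
    by (rule direl_d_map[rotated])
  thus ?thesis
    unfolding path_compose_join by (simp add: comp_def subdipath_def vertical_def horizontal_def)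
qed

lemma category_paste_squares:
  assumes E: "category E" and left: "l \<in> hom E x y" and top: "t \<in> hom E y y'" "t' \<in> hom E y' y''"
    and bottom: "b \<in> hom E x x'" "b' \<in> hom E x' x''"
    and middle: "m \<in> hom E x' y'" and right: "r \<in> hom E x'' y''"
    and squares: "Comp E t l = Comp E m b" "Comp E t' m = Comp E r b'"
  shows "Comp E (Comp E t' t) l = Comp E r (Comp E b' b)"
proof -
  have "Comp E (Comp E t' t) l = Comp E t' (Comp E m b)"
    by (simp add: squares(1)[symmetric] category_assoc[OF E left top])
  also have "\<dots> = Comp E (Comp E r b') b"
    by (simp add: squares(2)[symmetric] category_assoc[OF E bottom(1) middle top(2)])
  also have "\<dots> = Comp E r (Comp E b' b)" by (rule category_assoc[OF E bottom right, symmetric])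
  finally show ?thesis .
qed

section \<open>The van Kampen theorem for fundamental categories\<close>

locale d_cover =
  fixes X :: "'a::topological_space set" and D :: "(real \<Rightarrow> 'a) set"
    and K :: "'k set" and Y :: "'k \<Rightarrow> 'a set"
  assumes d_space_X: "d_space X D" and Y_subset: "\<And>k. k \<in> K \<Longrightarrow> Y k \<subseteq> X"
    and interior_cover: "X = (\<Union>k\<in>K. top_of_set X interior_of Y k)"
begin

lemma d_space_Y: "k \<in> K \<Longrightarrow> d_space (Y k) (dsub D (Y k))"
  by (rule d_space_dsub[OF d_space_X Y_subset])

lemma d_space_X': "d_space X (dsub D X)"
  using d_space_X by (simp add: dsub_self)

lemma interior_coverE:
  assumes "x \<in> X"
  obtains k U where "k \<in> K" "openin (top_of_set X) U" "x \<in> U" "U \<subseteq> Y k"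
proof -
  obtain k where "k \<in> K" "x \<in> top_of_set X interior_of Y k" using assms interior_cover by blast
  thus ?thesis using that by (auto simp: interior_of_def)
qed

lemma X_eq: "X = (\<Union>k\<in>K. Y k)"
proof (intro equalityI subsetI)
  fix x assume "x \<in> X"
  then obtain k U where "k \<in> K" "x \<in> U" "U \<subseteq> Y k" by (rule interior_coverE)
  thus "x \<in> (\<Union>k\<in>K. Y k)" by blast
qed (use Y_subset in blast)

lemma continuous_locally_in_piece:
  fixes g :: "'b::metric_space \<Rightarrow> 'a"
  assumes "continuous_on S g" "g ` S \<subseteq> X" "x \<in> S"
  obtains k e where "k \<in> K" "e > 0" "g ` (ball x e \<inter> S) \<subseteq> Y k"
proof -
  obtain k U where k: "k \<in> K" and U: "openin (top_of_set X) U" "g x \<in> U" "U \<subseteq> Y k"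
    using interior_coverE[of "g x"] assms by blast
  have "openin (top_of_set S) (S \<inter> g -` U)"
    using assms U by (intro continuous_openin_preimage) auto
  then obtain e where "e > 0" "ball x e \<inter> S \<subseteq> S \<inter> g -` U"
    using assms(3) U(2) unfolding openin_contains_ball by blast
  thus ?thesis using that[OF k, of e] U(3) by blast
qed

lemma dipath_piece_induct [consumes 4, case_names piece join]:
  assumes p: "p \<in> D" and ab: "0 \<le> a" "a \<le> b" "b \<le> 1"
    and piece: "\<And>k a b. k \<in> K \<Longrightarrow> 0 \<le> a \<Longrightarrow> a \<le> b \<Longrightarrow> b \<le> 1 \<Longrightarrow> p ` {a..b} \<subseteq> Y k \<Longrightarrow> R a b"
    and join: "\<And>a b c. 0 \<le> a \<Longrightarrow> a \<le> b \<Longrightarrow> b \<le> c \<Longrightarrow> c \<le> 1 \<Longrightarrow> R a b \<Longrightarrow> R b c \<Longrightarrow> R a c"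
  shows "R a b"
  using ab(2)
proof (induction rule: Bolzano_within)
  case (trans c d e)
  thus ?case using join[of c d e] ab by auto
next
  case (local x)
  hence "x \<in> {0..1}" using ab by auto
  with d_space_continuous[OF d_space_X p] d_space_image[OF d_space_X p]
  obtain k e where k: "k \<in> K" "e > 0" "p ` (ball x e \<inter> {0..1}) \<subseteq> Y k"
    by (rule continuous_locally_in_piece)
  have "R c d" if "a \<le> c" "c \<le> x" "x \<le> d" "d \<le> b" "d - c < e" for c d
  proof (rule piece[OF k(1)])
    have "{c..d} \<subseteq> ball x e \<inter> {0..1}" using that ab by (auto simp: dist_real_def)
    thus "p ` {c..d} \<subseteq> Y k" using k(3) by blast
  qed (use that ab in auto)
  thus ?case using k(2) by blast
qed

lemma fc_generated_by_pieces:
  "Mor (fc D X X) \<subseteq> comp_closure (fc D X X) (\<Union>k\<in>K. snd (incl D X) ` Mor (fc D (Y k) (Y k)))"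
  (is "_ \<subseteq> ?cl")
proof
  fix f assume "f \<in> Mor (fc D X X)"
  then obtain p where f: "f = path_mor D X p" and p: "p \<in> D" by (auto simp: Mor_fc dsub_def)
  have mem: "subdipath a b p \<in> dsub D X" if "0 \<le> a" "a \<le> b" "b \<le> 1" for a b
    using subdipath_in_d_space[OF d_space_X p that] by (simp add: dsub_self[OF d_space_X])
  have "path_mor D X (subdipath 0 1 p) \<in> ?cl"
    using p order_refl zero_le_one order_refl
  proof (induction rule: dipath_piece_induct)
    case (piece k a b)
    have sub: "subdipath a b p \<in> dsub D (Y k)"
      using piece by (intro subdipath_in_dsub[OF d_space_X p])
    have "path_mor D (Y k) (subdipath a b p) \<in> Mor (fc D (Y k) (Y k))"
      using hom_memD[OF path_mor_hom[OF d_space_Y[OF piece(1)] sub]] by simp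
    thus ?case
      using piece(1) incl_path_mor[OF Y_subset[OF piece(1)] sub, symmetric]
      by (intro generator UN_I[of k] image_eqI)
  next
    case (join a b c)
    have sub: "subdipath a b p \<in> dsub D X" "subdipath b c p \<in> dsub D X"
      using join by (auto intro!: mem)
    have "path_mor D X (subdipath a c p) = path_mor D X (subdipath a b p +++ subdipath b c p)"
      using join d_space_image[OF d_space_X p]
      by (intro path_mor_cong direl_subdipath_join[OF d_space_X p]) auto
    also have "\<dots> = Comp (fc D X X) (path_mor D X (subdipath b c p)) (path_mor D X (subdipath a b p))"
      by (simp add: Comp_path_mor[OF d_space_X' sub])
    finally show ?case
      using comp_closure.comp[OF join(5,6)] path_mor_hom[OF d_space_X' sub(1)]
        path_mor_hom[OF d_space_X' sub(2)] by simp
  qed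
  thus "f \<in> ?cl" using f by simp
qed

end

locale d_cover_cocone = d_cover X D K Y
  for X :: "'a::topological_space set" and D :: "(real \<Rightarrow> 'a) set" and K :: "'k set" and Y +
  fixes E :: "('oe, 'me) cat" and F :: "'k \<Rightarrow> ('a, 'a dmor, 'oe, 'me) ftr"
  assumes category_E: "category E" and functor_F: "\<And>k. k \<in> K \<Longrightarrow> is_functor (fc D (Y k) (Y k)) E (F k)"
    and F_obj_agree: "\<And>k k' x. k \<in> K \<Longrightarrow> k' \<in> K \<Longrightarrow> x \<in> Y k \<Longrightarrow> x \<in> Y k' \<Longrightarrow> fst (F k) x = fst (F k') x"
    and F_mor_agree: "\<And>k k' p. k \<in> K \<Longrightarrow> k' \<in> K \<Longrightarrow> p \<in> dsub D (Y k) \<Longrightarrow> p \<in> dsub D (Y k') \<Longrightarrow>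
      snd (F k) (path_mor D (Y k) p) = snd (F k') (path_mor D (Y k') p)"
begin

definition obj_val :: "'a \<Rightarrow> 'oe" where
  "obj_val = glue_fun K Y (\<lambda>k. fst (F k))"

lemma obj_val_eq: "k \<in> K \<Longrightarrow> x \<in> Y k \<Longrightarrow> obj_val x = fst (F k) x"
  unfolding obj_val_def by (rule glue_fun_eq) (assumption | rule F_obj_agree)+

definition piece_val :: "'k \<Rightarrow> (real \<Rightarrow> 'a) \<Rightarrow> 'me" where
  "piece_val k p = snd (F k) (path_mor D (Y k) p)"

lemma piece_val_cong: "(p, q) \<in> direl (Y k) (dsub D (Y k)) \<Longrightarrow> piece_val k p = piece_val k q"
  by (simp add: piece_val_def path_mor_cong)

lemma piece_val_hom:
  assumes k: "k \<in> K" and p: "p \<in> dsub D (Y k)"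
  shows "piece_val k p \<in> hom E (obj_val (p 0)) (obj_val (p 1))"
  using functor_hom[OF functor_F[OF k] path_mor_hom[OF d_space_Y[OF k] p]]
    d_space_endpoints[OF d_space_Y[OF k] p] k by (simp add: piece_val_def obj_val_eq)

lemma piece_val_join:
  assumes k: "k \<in> K" and p: "p \<in> dsub D (Y k)" and q: "q \<in> dsub D (Y k)" and ends: "p 1 = q 0"
  shows "piece_val k (p +++ q) = Comp E (piece_val k q) (piece_val k p)"
proof -
  note hom = path_mor_hom[OF d_space_Y[OF k]]
  show ?thesis
    using functor_comp[OF functor_F[OF k] hom[OF p] hom[OF q, folded ends]]
    by (simp add: piece_val_def Comp_path_mor[OF d_space_Y[OF k] p q ends])
qed

lemma piece_val_const: "k \<in> K \<Longrightarrow> x \<in> Y k \<Longrightarrow> piece_val k (\<lambda>t. x) = Id E (obj_val x)"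
  using functor_id[OF functor_F, of k x] by (simp add: piece_val_def obj_val_eq)

lemma piece_val_subdipath_join:
  assumes k: "k \<in> K" and p: "p \<in> D" and abc: "0 \<le> a" "a \<le> b" "b \<le> c" "c \<le> 1" and Y: "p ` {a..c} \<subseteq> Y k"
  shows "piece_val k (subdipath a c p) =
    Comp E (piece_val k (subdipath b c p)) (piece_val k (subdipath a b p))"
proof -
  have "p ` {a..b} \<subseteq> Y k" "p ` {b..c} \<subseteq> Y k" using Y abc by (auto simp: image_subset_iff)
  hence "subdipath a b p \<in> dsub D (Y k)" "subdipath b c p \<in> dsub D (Y k)"
    using abc by (auto intro!: subdipath_in_dsub[OF d_space_X p])
  thus ?thesis
    using piece_val_cong[OF direl_subdipath_join[OF d_space_X p abc Y]] piece_val_join[OF k] by simp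
qed

text \<open>The value of a subdivision is unique because it can be split at any intermediate point.\<close>
inductive is_subdivision_val :: "(real \<Rightarrow> 'a) \<Rightarrow> real \<Rightarrow> real \<Rightarrow> 'me \<Rightarrow> bool" for p where
  piece: "k \<in> K \<Longrightarrow> 0 \<le> a \<Longrightarrow> a \<le> b \<Longrightarrow> b \<le> 1 \<Longrightarrow> p ` {a..b} \<subseteq> Y k \<Longrightarrow>
    is_subdivision_val p a b (piece_val k (subdipath a b p))"
| join: "is_subdivision_val p a b m \<Longrightarrow> is_subdivision_val p b c m' \<Longrightarrow>
    is_subdivision_val p a c (Comp E m' m)"

lemma is_subdivision_val_hom:
  assumes "is_subdivision_val p a b m" "p \<in> D"
  shows "0 \<le> a \<and> a \<le> b \<and> b \<le> 1 \<and> m \<in> hom E (obj_val (p a)) (obj_val (p b))"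
  using assms
proof induction
  case (piece k a b)
  thus ?case
    using piece_val_hom[OF piece(1) subdipath_in_dsub[OF d_space_X piece(6,2,3,4,5)]] by simp
qed (auto intro: category_comp[OF category_E])

lemma is_subdivision_val_split:
  assumes "is_subdivision_val p a c m" "p \<in> D" "a \<le> b" "b \<le> c"
  shows "\<exists>m1 m2. is_subdivision_val p a b m1 \<and> is_subdivision_val p b c m2 \<and> m = Comp E m2 m1"
  using assms
proof (induction arbitrary: b)
  case (piece k a c)
  have "p ` {a..b} \<subseteq> Y k" "p ` {b..c} \<subseteq> Y k" using piece by (auto simp: image_subset_iff)
  hence "is_subdivision_val p a b (piece_val k (subdipath a b p))"
    "is_subdivision_val p b c (piece_val k (subdipath b c p))"
    using piece by (auto intro!: is_subdivision_val.piece)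
  thus ?case using piece piece_val_subdipath_join[of k p a b c] by blast
next
  case (join a d m c m')
  note assoc = category_assoc[OF category_E] and hom = is_subdivision_val_hom[OF _ \<open>p \<in> D\<close>]
  have m: "m \<in> hom E (obj_val (p a)) (obj_val (p d))"
    and m': "m' \<in> hom E (obj_val (p d)) (obj_val (p c))"
    using hom[OF join.hyps(1)] hom[OF join.hyps(2)] by auto
  show ?case
  proof (cases "b \<le> d")
    case True
    then obtain m1 m2 where split:
      "is_subdivision_val p a b m1" "is_subdivision_val p b d m2" "m = Comp E m2 m1"
      using join by blast
    have "Comp E m' m = Comp E (Comp E m' m2) m1"
      using assoc[OF _ _ m'] hom[OF split(1)] hom[OF split(2)] split(3) by blast
    thus ?thesis using split(1) is_subdivision_val.join[OF split(2) join.hyps(2)] by blast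
  next
    case False
    then obtain m1 m2 where split:
      "is_subdivision_val p d b m1" "is_subdivision_val p b c m2" "m' = Comp E m2 m1"
      using join by (metis linear)
    have "Comp E m' m = Comp E m2 (Comp E m1 m)"
      using assoc[OF m] hom[OF split(1)] hom[OF split(2)] split(3) by metis
    thus ?thesis using split(2) is_subdivision_val.join[OF join.hyps(1) split(1)] by blast
  qed
qed

lemma is_subdivision_val_piece_unique:
  assumes "is_subdivision_val p a b m" "p \<in> D" "k \<in> K" "p ` {a..b} \<subseteq> Y k"
  shows "m = piece_val k (subdipath a b p)"
  using assms
proof induction
  case (piece k' a b)
  thus ?case unfolding piece_val_def by (intro F_mor_agree subdipath_in_dsub[OF d_space_X])
next
  case (join a b m c m')
  have abc: "0 \<le> a" "a \<le> b" "b \<le> c" "c \<le> 1"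
    using join.hyps[THEN is_subdivision_val_hom, OF \<open>p \<in> D\<close>] by auto
  hence "p ` {a..b} \<subseteq> Y k" "p ` {b..c} \<subseteq> Y k" using join.prems by (auto simp: image_subset_iff)
  thus ?case using join piece_val_subdipath_join[OF _ _ abc, of k p] by simp
qed

lemma is_subdivision_val_unique:
  assumes "is_subdivision_val p a b m" "is_subdivision_val p a b m'" "p \<in> D"
  shows "m = m'"
  using assms
proof (induction arbitrary: m')
  case (piece k a b)
  thus ?case using is_subdivision_val_piece_unique[of p a b m' k] by auto
next
  case (join a b m c n)
  have "a \<le> b" "b \<le> c" using join.hyps[THEN is_subdivision_val_hom, OF \<open>p \<in> D\<close>] by auto
  with join.prems obtain m1 m2
    where "is_subdivision_val p a b m1" "is_subdivision_val p b c m2" "m' = Comp E m2 m1"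
    using is_subdivision_val_split by blast
  thus ?case using join by metis
qed

lemma is_subdivision_val_subdipath:
  assumes "is_subdivision_val (subdipath c d p) a b m" and cd: "0 \<le> c" "c \<le> d" "d \<le> 1"
  shows "is_subdivision_val p (linepath c d a) (linepath c d b) m"
  using assms(1)
proof induction
  case (piece k a b)
  let ?a = "linepath c d a" and ?b = "linepath c d b"
  have "?a \<in> {c..d}" "?b \<in> {c..d}"
    using mono_pathsD(2)[OF linepath_mono_path[OF order_refl cd(2) order_refl]] piece by auto
  moreover have "?a \<le> ?b" using piece cd by (intro linepath_mono) auto
  moreover have "p ` {?a..?b} = subdipath c d p ` {a..b}"
    using subdipath_image[OF \<open>?a \<le> ?b\<close>] subdipath_image[OF \<open>a \<le> b\<close>] subdipath_subdipath by metis
  ultimately show ?case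
    unfolding subdipath_subdipath using piece cd by (intro is_subdivision_val.piece) auto
qed (rule join)

lemma is_subdivision_val_cong:
  assumes "is_subdivision_val p a b m" and p: "p \<in> D" and q: "q \<in> D"
    and eq: "\<And>t. t \<in> {0..1} \<Longrightarrow> p t = q t"
  shows "is_subdivision_val q a b m"
  using assms(1)
proof induction
  case (piece k a b)
  have line: "linepath a b t \<in> {0..1}" if "t \<in> {0..1}" for t
    using mono_pathsD(2)[OF linepath_mono_path[OF order_refl \<open>a \<le> b\<close> order_refl] that] piece by auto
  have q_image: "q ` {a..b} \<subseteq> Y k" using piece eq by (force simp: image_subset_iff)
  have "piece_val k (subdipath a b p) = piece_val k (subdipath a b q)"
    using piece q_image line
    by (intro piece_val_cong direl_eq_on d_space_Y subdipath_in_dsub[OF d_space_X] p q)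
      (auto simp: subdipath_def eq)
  thus ?case using piece q_image by (auto intro: is_subdivision_val.piece)
qed (rule join)

definition dipath_val :: "(real \<Rightarrow> 'a) \<Rightarrow> real \<Rightarrow> real \<Rightarrow> 'me" where
  "dipath_val p a b = (THE m. is_subdivision_val p a b m)"

lemma dipath_val_eqI: "is_subdivision_val p a b m \<Longrightarrow> p \<in> D \<Longrightarrow> dipath_val p a b = m"
  unfolding dipath_val_def using is_subdivision_val_unique by blast

lemma is_subdivision_val_dipath_val:
  assumes "p \<in> D" "0 \<le> a" "a \<le> b" "b \<le> 1"
  shows "is_subdivision_val p a b (dipath_val p a b)"
proof -
  have "\<exists>m. is_subdivision_val p a b m"
    using assms by (induction rule: dipath_piece_induct) (blast intro: piece join)+
  thus ?thesis using dipath_val_eqI assms(1) by blast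
qed

lemma dipath_val_hom:
  "p \<in> D \<Longrightarrow> 0 \<le> a \<Longrightarrow> a \<le> b \<Longrightarrow> b \<le> 1 \<Longrightarrow> dipath_val p a b \<in> hom E (obj_val (p a)) (obj_val (p b))"
  using is_subdivision_val_hom[OF is_subdivision_val_dipath_val] by blast

lemma dipath_val_split:
  assumes "p \<in> D" "0 \<le> a" "a \<le> b" "b \<le> c" "c \<le> 1"
  shows "dipath_val p a c = Comp E (dipath_val p b c) (dipath_val p a b)"
  using assms by (intro dipath_val_eqI join[of p a b _ c] is_subdivision_val_dipath_val) auto

lemma dipath_val_piece:
  assumes "p \<in> D" "k \<in> K" "0 \<le> a" "a \<le> b" "b \<le> 1" "p ` {a..b} \<subseteq> Y k"
  shows "dipath_val p a b = piece_val k (subdipath a b p)"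
  using assms by (intro dipath_val_eqI piece) auto

lemma dipath_val_subdipath:
  assumes "p \<in> D" "0 \<le> a" "a \<le> b" "b \<le> 1"
  shows "dipath_val (subdipath a b p) 0 1 = dipath_val p a b"
proof -
  have "is_subdivision_val (subdipath a b p) 0 1 (dipath_val (subdipath a b p) 0 1)"
    using assms by (intro is_subdivision_val_dipath_val subdipath_in_d_space[OF d_space_X]) auto
  from is_subdivision_val_subdipath[OF this assms(2-4)] show ?thesis
    using dipath_val_eqI assms(1) by (simp add: linepath_0' linepath_1')
qed

lemma dipath_val_cong:
  assumes "p \<in> D" "q \<in> D" "\<And>t. t \<in> {0..1} \<Longrightarrow> p t = q t"
  shows "dipath_val p 0 1 = dipath_val q 0 1"
  using is_subdivision_val_cong[OF is_subdivision_val_dipath_val assms, of 0 1] assms(1,2)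
  by (simp add: dipath_val_eqI)

lemma dipath_val_const:
  assumes "x \<in> X"
  shows "dipath_val (\<lambda>t. x) 0 1 = Id E (obj_val x)"
proof -
  obtain k where k: "k \<in> K" "x \<in> Y k" using X_eq assms by blast
  show ?thesis
    using dipath_val_piece[OF d_space_const[OF d_space_X assms] k(1), of 0 1] k piece_val_const[OF k]
    by (simp add: image_subset_iff)
qed

lemma dipath_val_joinpaths:
  assumes p: "p \<in> D" and q: "q \<in> D" and ends: "p 1 = q 0"
  shows "dipath_val (p +++ q) 0 1 = Comp E (dipath_val q 0 1) (dipath_val p 0 1)"
proof -
  have pq: "p +++ q \<in> D" using p q ends by (rule d_space_join[OF d_space_X])
  have "dipath_val p 0 1 = dipath_val (subdipath 0 (1/2) (p +++ q)) 0 1"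
    by (intro dipath_val_cong p subdipath_in_d_space[OF d_space_X pq])
      (simp_all add: subdipath_joinpaths_left)
  moreover have "dipath_val q 0 1 = dipath_val (subdipath (1/2) 1 (p +++ q)) 0 1"
    by (intro dipath_val_cong q subdipath_in_d_space[OF d_space_X pq])
      (simp_all add: subdipath_joinpaths_right[of p q, OF ends])
  ultimately show ?thesis
    using dipath_val_subdipath[OF pq] dipath_val_split[OF pq, of 0 "1/2" 1] by simp
qed

definition rectangle_commutes :: "(real \<times> real \<Rightarrow> 'a) \<Rightarrow> real \<Rightarrow> real \<Rightarrow> real \<Rightarrow> real \<Rightarrow> bool" where
  "rectangle_commutes H a b c d \<longleftrightarrow>
     Comp E (dipath_val (\<lambda>s. H (s, d)) a b) (dipath_val (\<lambda>t. H (a, t)) c d) =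
     Comp E (dipath_val (\<lambda>t. H (b, t)) c d) (dipath_val (\<lambda>s. H (s, c)) a b)"

lemma rectangle_commutes_join_fst:
  assumes H: "d_square X D H"
    and ab: "0 \<le> a" "a \<le> b" "b \<le> b'" "b' \<le> 1" and cd: "0 \<le> c" "c \<le> d" "d \<le> 1"
    and commutes: "rectangle_commutes H a b c d" "rectangle_commutes H b b' c d"
  shows "rectangle_commutes H a b' c d"
proof -
  have mem: "(\<lambda>s. H (s, c)) \<in> D" "(\<lambda>s. H (s, d)) \<in> D"
    "(\<lambda>t. H (a, t)) \<in> D" "(\<lambda>t. H (b, t)) \<in> D" "(\<lambda>t. H (b', t)) \<in> D"
    using ab cd by (auto intro!: d_square_edges[OF H])
  show ?thesis
    unfolding rectangle_commutes_def dipath_val_split[OF mem(1) ab] dipath_val_split[OF mem(2) ab]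
    using ab cd
    by (intro category_paste_squares[OF category_E dipath_val_hom[OF mem(3)]
        dipath_val_hom[OF mem(2)] dipath_val_hom[OF mem(2)]
        dipath_val_hom[OF mem(1)] dipath_val_hom[OF mem(1)]
        dipath_val_hom[OF mem(4)] dipath_val_hom[OF mem(5)]
        commutes[unfolded rectangle_commutes_def]]) auto
qed

lemma rectangle_commutes_swap:
  "rectangle_commutes (H \<circ> prod.swap) c d a b \<longleftrightarrow> rectangle_commutes H a b c d"
  by (auto simp: rectangle_commutes_def)

lemma rectangle_commutes_join_snd:
  assumes H: "d_square X D H"
    and cd: "0 \<le> c" "c \<le> d" "d \<le> d'" "d' \<le> 1" and ab: "0 \<le> a" "a \<le> b" "b \<le> 1"
    and "rectangle_commutes H a b c d" "rectangle_commutes H a b d d'"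
  shows "rectangle_commutes H a b c d'"
proof -
  have "d_square X D (H \<circ> prod.swap)" by (rule d_map_comp[OF d_square_swap H])
  from rectangle_commutes_join_fst[OF this cd ab] show ?thesis
    using assms(9,10) by (simp only: rectangle_commutes_swap)
qed

lemma rectangle_commutes_piece:
  assumes H: "d_square X D H" and k: "k \<in> K"
    and ab: "0 \<le> a" "a \<le> b" "b \<le> 1" and cd: "0 \<le> c" "c \<le> d" "d \<le> 1"
    and Y: "H ` ({a..b} \<times> {c..d}) \<subseteq> Y k"
  shows "rectangle_commutes H a b c d"
proof -
  have vertical: "dipath_val (\<lambda>t. H (x, t)) c d = piece_val k (subdipath c d (\<lambda>t. H (x, t)))"
    "subdipath c d (\<lambda>t. H (x, t)) \<in> dsub D (Y k)" if "x \<in> {a..b}" for x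
  proof -
    have "(\<lambda>t. H (x, t)) \<in> D" using that ab by (intro d_square_edges[OF H]) auto
    moreover have "(\<lambda>t. H (x, t)) ` {c..d} \<subseteq> Y k" using that Y by auto
    ultimately show "dipath_val (\<lambda>t. H (x, t)) c d = piece_val k (subdipath c d (\<lambda>t. H (x, t)))"
      "subdipath c d (\<lambda>t. H (x, t)) \<in> dsub D (Y k)"
      using k cd by (auto intro: dipath_val_piece subdipath_in_dsub[OF d_space_X])
  qed
  have horizontal: "dipath_val (\<lambda>s. H (s, y)) a b = piece_val k (subdipath a b (\<lambda>s. H (s, y)))"
    "subdipath a b (\<lambda>s. H (s, y)) \<in> dsub D (Y k)" if "y \<in> {c..d}" for y
  proof -
    have "(\<lambda>s. H (s, y)) \<in> D" using that cd by (intro d_square_edges[OF H]) auto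
    moreover have "(\<lambda>s. H (s, y)) ` {a..b} \<subseteq> Y k" using that Y by auto
    ultimately show "dipath_val (\<lambda>s. H (s, y)) a b = piece_val k (subdipath a b (\<lambda>s. H (s, y)))"
      "subdipath a b (\<lambda>s. H (s, y)) \<in> dsub D (Y k)"
      using k ab by (auto intro: dipath_val_piece subdipath_in_dsub[OF d_space_X])
  qed
  show ?thesis
    using piece_val_cong[OF direl_rectangle_boundary[OF H ab cd Y]] ab cd
    by (simp add: rectangle_commutes_def vertical horizontal piece_val_join[OF k])
qed

definition thin_strip_commutes :: "(real \<times> real \<Rightarrow> 'a) \<Rightarrow> real \<Rightarrow> real \<Rightarrow> real \<Rightarrow> bool" where
  "thin_strip_commutes H s c d \<longleftrightarrow>
     (\<exists>\<delta>>0. \<forall>a b. 0 \<le> a \<and> a \<le> s \<and> s \<le> b \<and> b \<le> 1 \<and> b - a < \<delta> \<longrightarrow> rectangle_commutes H a b c d)"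

lemma thin_strip_commutes_join:
  assumes H: "d_square X D H" and cd: "0 \<le> c" "c \<le> d" "d \<le> d'" "d' \<le> 1"
    and commutes: "thin_strip_commutes H s c d" "thin_strip_commutes H s d d'"
  shows "thin_strip_commutes H s c d'"
proof -
  obtain \<delta> \<delta>' where pos: "\<delta> > 0" "\<delta>' > 0"
    and "\<forall>a b. 0 \<le> a \<and> a \<le> s \<and> s \<le> b \<and> b \<le> 1 \<and> b - a < \<delta> \<longrightarrow> rectangle_commutes H a b c d"
    and "\<forall>a b. 0 \<le> a \<and> a \<le> s \<and> s \<le> b \<and> b \<le> 1 \<and> b - a < \<delta>' \<longrightarrow> rectangle_commutes H a b d d'"
    using commutes unfolding thin_strip_commutes_def by blast
  hence "rectangle_commutes H a b c d'" if "0 \<le> a \<and> a \<le> s \<and> s \<le> b \<and> b \<le> 1 \<and> b - a < min \<delta> \<delta>'" for a b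
    using that by (intro rectangle_commutes_join_snd[OF H cd]) auto
  thus ?thesis unfolding thin_strip_commutes_def using pos by (intro exI[of _ "min \<delta> \<delta>'"]) auto
qed

lemma thin_strip_commutes_locally:
  assumes H: "d_square X D H" and st: "s \<in> {0..1}" "t \<in> {0..1}"
  obtains \<delta> where "\<delta> > 0"
    "\<And>c d. 0 \<le> c \<Longrightarrow> c \<le> t \<Longrightarrow> t \<le> d \<Longrightarrow> d \<le> 1 \<Longrightarrow> d - c < \<delta> \<Longrightarrow> thin_strip_commutes H s c d"
proof -
  obtain k e where k: "k \<in> K" "e > 0" "H ` (ball (s, t) e \<inter> unit_square) \<subseteq> Y k"
    using continuous_locally_in_piece[OF d_mapD(1,2)[OF H], of "(s, t)"] st by auto
  have "rectangle_commutes H a b c d"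
    if ab: "0 \<le> a" "a \<le> s" "s \<le> b" "b \<le> 1" "b - a < e / 2"
      and cd: "0 \<le> c" "c \<le> t" "t \<le> d" "d \<le> 1" "d - c < e / 2" for a b c d
  proof (rule rectangle_commutes_piece[OF H k(1)])
    have "{a..b} \<times> {c..d} \<subseteq> ball (s, t) e \<inter> unit_square"
    proof clarify
      fix x y assume xy: "x \<in> {a..b}" "y \<in> {c..d}"
      have "dist (s, t) (x, y) \<le> \<bar>s - x\<bar> + \<bar>t - y\<bar>"
        using sqrt_sum_squares_le_sum_abs[of "s - x" "t - y"]
        by (simp add: dist_Pair_Pair dist_real_def)
      also have "\<dots> < e" using ab cd xy by auto
      finally show "(x, y) \<in> ball (s, t) e \<inter> unit_square" using ab cd xy by auto
    qed
    thus "H ` ({a..b} \<times> {c..d}) \<subseteq> Y k" using k(3) by blast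
  qed (use ab cd in auto)
  thus ?thesis
    using k(2)
    by (intro that[of "e / 2"]) (auto simp: thin_strip_commutes_def intro!: exI[of _ "e / 2"])
qed

lemma unit_square_commutes:
  assumes H: "d_square X D H"
  shows "rectangle_commutes H 0 1 0 1"
  using zero_le_one
proof (induction rule: Bolzano_within[where P = "\<lambda>a b. rectangle_commutes H a b 0 1"])
  case (trans a b c)
  thus ?case using rectangle_commutes_join_fst[OF H, of a b c 0 1] by auto
next
  case (local s)
  have "thin_strip_commutes H s 0 1"
    using zero_le_one
  proof (induction rule: Bolzano_within[where P = "thin_strip_commutes H s"])
    case (trans c d d')
    thus ?case by (intro thin_strip_commutes_join[OF H, of c d d'])
  next
    case (local t)
    obtain \<delta> where "\<delta> > 0"
      "\<And>c d. 0 \<le> c \<Longrightarrow> c \<le> t \<Longrightarrow> t \<le> d \<Longrightarrow> d \<le> 1 \<Longrightarrow> d - c < \<delta> \<Longrightarrow> thin_strip_commutes H s c d"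
      using thin_strip_commutes_locally[OF H, of s t] \<open>0 \<le> s\<close> \<open>s \<le> 1\<close> local by auto
    thus ?case by blast
  qed
  thus ?case by (simp add: thin_strip_commutes_def)
qed

lemma dipath_val_dihtpy:
  assumes p: "p \<in> D" and q: "q \<in> D" and "dihtpy X D p q"
  shows "dipath_val p 0 1 = dipath_val q 0 1"
proof -
  obtain H where H: "d_square X D H" and sides: "\<forall>t\<in>{0..1}. H (0, t) = p t \<and> H (1, t) = q t"
    and ends: "\<forall>s\<in>{0..1}. H (s, 0) = p 0 \<and> H (s, 1) = p 1"
    using assms(3) unfolding dihtpy_iff_d_square by blast
  have pX: "p 0 \<in> X" "p 1 \<in> X" using d_space_endpoints[OF d_space_X p] .
  have "dipath_val (\<lambda>t. H (0, t)) 0 1 = dipath_val p 0 1"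
    "dipath_val (\<lambda>t. H (1, t)) 0 1 = dipath_val q 0 1"
    using p q sides by (auto intro!: dipath_val_cong d_square_edges[OF H])
  moreover have "dipath_val (\<lambda>s. H (s, 0)) 0 1 = Id E (obj_val (p 0))"
    "dipath_val (\<lambda>s. H (s, 1)) 0 1 = Id E (obj_val (p 1))"
    unfolding dipath_val_const[OF pX(1), symmetric] dipath_val_const[OF pX(2), symmetric]
    using ends pX by (auto intro!: dipath_val_cong d_square_edges[OF H] d_space_const[OF d_space_X])
  ultimately
  have "Comp E (Id E (obj_val (p 1))) (dipath_val p 0 1) =
      Comp E (dipath_val q 0 1) (Id E (obj_val (p 0)))"
    using unit_square_commutes[OF H] unfolding rectangle_commutes_def by simp
  thus ?thesis
    using category_id_left[OF category_E dipath_val_hom[OF p, of 0 1]]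
      category_id_right[OF category_E dipath_val_hom[OF q, of 0 1]] dihtpy_endpoints[OF assms(3)]
    by simp
qed

lemma dipath_val_direl: "(p, q) \<in> direl X D \<Longrightarrow> dipath_val p 0 1 = dipath_val q 0 1"
  by (induction rule: direl_induct) (auto intro: dipath_val_dihtpy)

definition glued :: "('a, 'a dmor, 'oe, 'me) ftr" where
  "glued = (obj_val, \<lambda>f. dipath_val (rep (snd (snd f))) 0 1)"

lemma glued_obj: "fst glued x = obj_val x"
  by (simp add: glued_def)

lemma glued_path_mor: "p \<in> D \<Longrightarrow> snd glued (path_mor D X p) = dipath_val p 0 1"
  using dipath_val_direl[OF rep_dclass, of p]
  by (simp add: glued_def path_mor_def dsub_self[OF d_space_X])

lemma functor_glued: "is_functor (fc D X X) E glued"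
  unfolding is_functor_def
proof (intro conjI ballI impI)
  fix x assume "x \<in> Obj (fc D X X)"
  hence x: "x \<in> X" by simp
  show "fst glued x \<in> Obj E"
    using category_dom[OF category_E dipath_val_hom[OF d_space_const[OF d_space_X x], of 0 1]]
    by (simp add: glued_obj)
  show "snd glued (Id (fc D X X) x) = Id E (fst glued x)"
    using x by (simp add: glued_obj glued_path_mor d_space_const[OF d_space_X] dipath_val_const)
next
  fix f assume "f \<in> Mor (fc D X X)"
  then obtain p where f: "f = path_mor D X p" and p: "p \<in> D" by (auto simp: Mor_fc dsub_def)
  show "snd glued f \<in> hom E (fst glued (Dom (fc D X X) f)) (fst glued (Cod (fc D X X) f))"
    using dipath_val_hom[OF p, of 0 1] by (simp add: f glued_obj glued_path_mor[OF p])
  fix g assume "g \<in> Mor (fc D X X)" and ends: "Cod (fc D X X) f = Dom (fc D X X) g"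
  then obtain q where g: "g = path_mor D X q" and q: "q \<in> D" by (auto simp: Mor_fc dsub_def)
  show "snd glued (Comp (fc D X X) g f) = Comp E (snd glued g) (snd glued f)"
    using ends p q
    by (simp add: f g Comp_path_mor[OF d_space_X'] dsub_self[OF d_space_X] glued_path_mor
        d_space_join[OF d_space_X] dipath_val_joinpaths)
qed

lemma glued_incl:
  assumes k: "k \<in> K"
  shows "fun_eq_on (fc D (Y k) (Y k)) (glued \<circ>\<^sub>F incl D X) (F k)"
proof -
  have "snd glued (snd (incl D X) f) = snd (F k) f" if f: "f \<in> Mor (fc D (Y k) (Y k))" for f
  proof -
    obtain p where p: "f = path_mor D (Y k) p" "p \<in> dsub D (Y k)" using f by (auto simp: Mor_fc)
    hence pD: "p \<in> D" "p ` {0..1} \<subseteq> Y k" by (auto simp: dsub_def)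
    show ?thesis
      using dipath_val_piece[OF pD(1) k _ _ _ pD(2)] incl_path_mor[OF Y_subset[OF k] p(2)]
      by (simp add: p(1) glued_path_mor pD(1) piece_val_def)
  qed
  thus ?thesis using k by (simp add: fun_eq_on_def glued_obj obj_val_eq)
qed

lemma glued_unique:
  assumes H: "is_functor (fc D X X) E H"
    and HF: "\<And>k. k \<in> K \<Longrightarrow> fun_eq_on (fc D (Y k) (Y k)) (H \<circ>\<^sub>F incl D X) (F k)"
  shows "fun_eq_on (fc D X X) glued H"
proof -
  have agree: "fun_eq_on (fc D (Y k) (Y k)) (glued \<circ>\<^sub>F incl D X) (H \<circ>\<^sub>F incl D X)" if "k \<in> K" for k
    using glued_incl[OF that] fun_eq_on_sym[OF HF[OF that]] by (rule fun_eq_on_trans)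
  have "fst glued x = fst H x" if "x \<in> X" for x
    using that X_eq fun_eq_on_obj[OF agree] by fastforce
  moreover have "snd glued f = snd H f" if "f \<in> Mor (fc D X X)" for f
    using subsetD[OF fc_generated_by_pieces that] functor_glued H
  proof (rule functor_eq_on_comp_closure)
    fix s assume "s \<in> (\<Union>k\<in>K. snd (incl D X) ` Mor (fc D (Y k) (Y k)))"
    thus "snd glued s = snd H s" using fun_eq_on_mor[OF agree] by auto
  qed
  ultimately show ?thesis by (simp add: fun_eq_on_def)
qed

end

lemma functors_agree_on_overlap:
  assumes eq: "fun_eq_on (fc D (X1 \<inter> X2) (X1 \<inter> X2)) (H1 \<circ>\<^sub>F incl D X1) (H2 \<circ>\<^sub>F incl D X2)"
    and p: "p \<in> dsub D X1" "p \<in> dsub D X2"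
  shows "snd H1 (path_mor D X1 p) = snd H2 (path_mor D X2 p)"
proof -
  have p0: "p \<in> dsub D (X1 \<inter> X2)" using p by (auto simp: dsub_def)
  hence "p 0 \<in> X1 \<inter> X2" "p 1 \<in> X1 \<inter> X2" by (auto simp: dsub_def image_subset_iff)
  hence "path_mor D (X1 \<inter> X2) p \<in> Mor (fc D (X1 \<inter> X2) (X1 \<inter> X2))"
    by (rule path_mor_in_Mor[OF p0])
  from fun_eq_on_mor[OF eq this] show ?thesis
    by (simp add: incl_path_mor[OF Int_lower1 p0] incl_path_mor[OF Int_lower2 p0])
qed

lemma fund_cat_mediator:
  fixes X :: "'a::topological_space set" and E :: "('oe, 'me) cat"
  assumes X: "d_space X D" and sub: "X1 \<subseteq> X" "X2 \<subseteq> X"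
    and cover: "X = (top_of_set X interior_of X1) \<union> (top_of_set X interior_of X2)"
    and E: "category E" and H: "is_functor (fc D X1 X1) E H1" "is_functor (fc D X2 X2) E H2"
    and eq: "fun_eq_on (fc D (X1 \<inter> X2) (X1 \<inter> X2)) (H1 \<circ>\<^sub>F incl D X1) (H2 \<circ>\<^sub>F incl D X2)"
  shows "\<exists>H. mediates (fc D X1 X1) (fc D X2 X2) (fc D X X) E (incl D X) (incl D X) H1 H2 H \<and>
    (\<forall>H'. mediates (fc D X1 X1) (fc D X2 X2) (fc D X X) E (incl D X) (incl D X) H1 H2 H' \<longrightarrow>
      fun_eq_on (fc D X X) H H')"
proof -
  define Y where "Y = (\<lambda>k. if k then X1 else X2)"
  define F where "F = (\<lambda>k. if k then H1 else H2)"
  interpret d_cover_cocone X D "UNIV :: bool set" Y E F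
  proof
    show "X = (\<Union>k\<in>UNIV. top_of_set X interior_of Y k)" using cover by (auto simp: Y_def UNIV_bool)
    show "fst (F k) x = fst (F k') x" if "x \<in> Y k" "x \<in> Y k'" for k k' x
      using that fun_eq_on_obj[OF eq] by (auto simp: Y_def F_def split: if_splits)
    show "snd (F k) (path_mor D (Y k) p) = snd (F k') (path_mor D (Y k') p)"
      if "p \<in> dsub D (Y k)" "p \<in> dsub D (Y k')" for k k' p
      using that functors_agree_on_overlap[OF eq] by (auto simp: Y_def F_def split: if_splits)
  qed (use X sub E H in \<open>auto simp: Y_def F_def split: if_splits\<close>)
  show ?thesis
  proof (intro exI[of _ glued] conjI allI impI)
    show "mediates (fc D X1 X1) (fc D X2 X2) (fc D X X) E (incl D X) (incl D X) H1 H2 glued"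
      using functor_glued glued_incl[of True] glued_incl[of False]
      by (simp add: mediates_def Y_def F_def)
    fix H' assume "mediates (fc D X1 X1) (fc D X2 X2) (fc D X X) E (incl D X) (incl D X) H1 H2 H'"
    thus "fun_eq_on (fc D X X) glued H'"
      by (intro glued_unique) (auto simp: mediates_def Y_def F_def)
  qed
qed

theorem van_Kampen:
  fixes X :: "'a::topological_space set"
  assumes X: "d_space X D" and sub: "X1 \<subseteq> X" "X2 \<subseteq> X"
    and cover: "X = (top_of_set X interior_of X1) \<union> (top_of_set X interior_of X2)"
  shows "is_pushout TYPE(('oe, 'me) cat)
           (fc D (X1 \<inter> X2) (X1 \<inter> X2)) (fc D X1 X1) (fc D X2 X2) (fc D X X)
           (incl D X1) (incl D X2) (incl D X) (incl D X)"
    (is "is_pushout _ ?C0 ?C1 ?C2 ?CX _ _ _ _")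
proof (rule is_pushoutI)
  have "X1 \<inter> X2 \<subseteq> X" using sub by auto
  note d_spaces = d_space_dsub[OF X this] d_space_dsub[OF X sub(1)] d_space_dsub[OF X sub(2)]
    d_space_dsub[OF X order_refl]
  show "category ?C0" "category ?C1" "category ?C2" "category ?CX"
    by (intro category_fc d_spaces order_refl)+
  show "is_functor ?C0 ?C1 (incl D X1)" "is_functor ?C0 ?C2 (incl D X2)"
    "is_functor ?C1 ?CX (incl D X)" "is_functor ?C2 ?CX (incl D X)"
    by (intro functor_incl d_spaces order_refl Int_lower1 Int_lower2 sub)+
  show "fun_eq_on ?C0 (incl D X \<circ>\<^sub>F incl D X1) (incl D X \<circ>\<^sub>F incl D X2)"
    using fun_eq_on_incl_incl[OF Int_lower1 sub(1)]
      fun_eq_on_sym[OF fun_eq_on_incl_incl[OF Int_lower2 sub(2)]] by (rule fun_eq_on_trans)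
qed (rule fund_cat_mediator[OF X sub cover])

section \<open>Compatible chains of retracts\<close>

locale compatible_chains =
  fixes X :: "'a::topological_space set" and D :: "(real \<Rightarrow> 'a) set" and n :: nat
    and XX :: "nat \<Rightarrow> nat \<Rightarrow> 'a set"
    and P :: "nat \<Rightarrow> nat \<Rightarrow> ('a, 'a dmor, 'a, 'a dmor) ftr"
    and u :: "nat \<Rightarrow> nat \<Rightarrow> 'a \<Rightarrow> 'a dmor"
    and fut :: "nat \<Rightarrow> bool"
  assumes d_space_X: "d_space X D" and XX_subset_X: "XX 1 0 \<subseteq> X" "XX 2 0 \<subseteq> X"
    and cover: "X = (top_of_set X interior_of XX 1 0) \<union> (top_of_set X interior_of XX 2 0)"
    and XX_Int: "\<And>l. l \<le> n \<Longrightarrow> XX 0 l = XX 1 l \<inter> XX 2 l"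
    and XX_Suc: "\<And>k l. k \<le> 2 \<Longrightarrow> l < n \<Longrightarrow> XX k (Suc l) \<subseteq> XX k l"
    and retract_P: "\<And>k l. k \<le> 2 \<Longrightarrow> l < n \<Longrightarrow>
      retract (fut (Suc l)) (fc D (XX k 0) (XX k l)) (fc D (XX k 0) (XX k (Suc l)))
        (P k (Suc l)) (u k (Suc l))"
    and P_incl: "\<And>k l. k \<in> {1, 2} \<Longrightarrow> l < n \<Longrightarrow> fun_eq_on (fc D (XX 0 0) (XX 0 l))
      (P k (Suc l) \<circ>\<^sub>F incl D (XX k 0)) (incl D (XX k 0) \<circ>\<^sub>F P 0 (Suc l))"
    and u_incl: "\<And>k l x. k \<in> {1, 2} \<Longrightarrow> l < n \<Longrightarrow> x \<in> XX 0 l \<Longrightarrow>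
      snd (incl D (XX k 0)) (u 0 (Suc l) x) = u k (Suc l) x"
begin

abbreviation part_cat :: "nat \<Rightarrow> nat \<Rightarrow> ('a, 'a dmor) cat" where
  "part_cat k l \<equiv> fc D (XX k 0) (XX k l)"

abbreviation total_cat :: "nat \<Rightarrow> ('a, 'a dmor) cat" where
  "total_cat l \<equiv> fc D X (XX 1 l \<union> XX 2 l)"

abbreviation level_pushout :: "('oe, 'me) cat itself \<Rightarrow> nat \<Rightarrow> bool" where
  "level_pushout T l \<equiv> is_pushout T (part_cat 0 l) (part_cat 1 l) (part_cat 2 l) (total_cat l)
     (incl D (XX 1 0)) (incl D (XX 2 0)) (incl D X) (incl D X)"

definition generated :: "nat \<Rightarrow> bool" where
  "generated l \<longleftrightarrow>
     Mor (total_cat l) \<subseteq> comp_closure (total_cat l) (\<Union>k\<in>{1, 2}. snd (incl D X) ` Mor (part_cat k l))"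

definition glues_retracts :: "nat \<Rightarrow> ('a, 'a dmor, 'a, 'a dmor) ftr \<Rightarrow> bool" where
  "glues_retracts l Q \<longleftrightarrow> is_functor (total_cat (l - 1)) (total_cat l) Q \<and>
     (\<forall>k\<in>{1, 2}. fun_eq_on (part_cat k (l - 1)) (Q \<circ>\<^sub>F incl D X) (incl D X \<circ>\<^sub>F P k l))"

lemma glues_retracts_Suc:
  "glues_retracts (Suc l) Q \<longleftrightarrow> is_functor (total_cat l) (total_cat (Suc l)) Q \<and>
     (\<forall>k\<in>{1, 2}. fun_eq_on (part_cat k l) (Q \<circ>\<^sub>F incl D X) (incl D X \<circ>\<^sub>F P k (Suc l)))"
  by (simp add: glues_retracts_def)

lemma XX_subset_0: "k \<le> 2 \<Longrightarrow> l \<le> n \<Longrightarrow> XX k l \<subseteq> XX k 0"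
proof (induction l)
  case (Suc l)
  thus ?case using XX_Suc[of k l] by auto
qed simp

lemma XX_0_subset_X: "k \<le> 2 \<Longrightarrow> XX k 0 \<subseteq> X"
  using XX_subset_X XX_Int[of 0] by (auto simp: numeral_2_eq_2 le_Suc_eq)

lemma XX_Un_0: "XX 1 0 \<union> XX 2 0 = X"
  using cover XX_subset_X interior_of_subset[of "top_of_set X" "XX 1 0"]
    interior_of_subset[of "top_of_set X" "XX 2 0"] by blast

lemma XX_Un_subset_X: "l \<le> n \<Longrightarrow> XX 1 l \<union> XX 2 l \<subseteq> X"
  using XX_subset_0[of 1 l] XX_subset_0[of 2 l] XX_subset_X by auto

lemma d_space_part: "k \<le> 2 \<Longrightarrow> d_space (XX k 0) (dsub D (XX k 0))"
  by (rule d_space_dsub[OF d_space_X XX_0_subset_X])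

lemma category_part: "k \<le> 2 \<Longrightarrow> l \<le> n \<Longrightarrow> category (part_cat k l)"
  by (intro category_fc d_space_part XX_subset_0)

lemma category_total: "l \<le> n \<Longrightarrow> category (total_cat l)"
  by (intro category_fc d_space_dsub[OF d_space_X order_refl] XX_Un_subset_X)

lemma functor_part_total:
  assumes "k \<in> {1, 2}" "l \<le> n"
  shows "is_functor (part_cat k l) (total_cat l) (incl D X)"
proof (rule functor_incl[OF d_space_part d_space_dsub[OF d_space_X order_refl]])
  show "k \<le> 2" "XX k l \<subseteq> XX 1 l \<union> XX 2 l" using assms(1) by auto
  thus "XX k 0 \<subseteq> X" "XX k l \<subseteq> XX k 0" using assms(2) by (intro XX_0_subset_X XX_subset_0; simp)+
qed

lemma full_sub_part: "k \<le> 2 \<Longrightarrow> l < n \<Longrightarrow> full_sub (part_cat k (Suc l)) (part_cat k l)"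
  by (intro full_sub_fc XX_Suc)

lemma full_sub_total: "l < n \<Longrightarrow> full_sub (total_cat (Suc l)) (total_cat l)"
  using XX_Suc[of 1 l] XX_Suc[of 2 l] by (intro full_sub_fc Un_mono) auto

lemma cat_retraction_P:
  "k \<le> 2 \<Longrightarrow> l < n \<Longrightarrow> cat_retraction (part_cat k l) (part_cat k (Suc l)) (P k (Suc l))"
  using retract_cat_retraction[OF category_part full_sub_part retract_P] by simp

lemma glues_retracts_iff_mediates:
  "glues_retracts (Suc l) Q \<longleftrightarrow> mediates (part_cat 1 l) (part_cat 2 l) (total_cat l) (total_cat (Suc l))
     (incl D X) (incl D X) (incl D X \<circ>\<^sub>F P 1 (Suc l)) (incl D X \<circ>\<^sub>F P 2 (Suc l)) Q"
  by (simp add: glues_retracts_def mediates_def)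

lemma glues_retracts_exists:
  assumes l: "l < n" and po: "level_pushout TYPE(('a, 'a dmor) cat) l"
  obtains Q where "glues_retracts (Suc l) Q"
    "\<forall>Q'. glues_retracts (Suc l) Q' \<longrightarrow> fun_eq_on (total_cat l) Q Q'"
  unfolding glues_retracts_iff_mediates
  by (rule pushout_retraction_functor[OF po cat_retraction_P retract_functor[OF retract_P]
        retract_functor[OF retract_P] P_incl P_incl full_sub_total
        functor_part_total functor_part_total])
    (use l in auto)

lemma retract_cocone_level:
  assumes l: "l < n" and "glues_retracts (Suc l) Q" "generated l"
  shows "retract_cocone {1, 2} (\<lambda>k. part_cat k l) (\<lambda>k. part_cat k (Suc l))
    (total_cat l) (total_cat (Suc l)) (\<lambda>k. incl D X) (\<lambda>k. P k (Suc l)) Q"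
proof
  have l': "l \<le> n" using l by simp
  show "category (total_cat l)" by (rule category_total[OF l'])
  show "full_sub (total_cat (Suc l)) (total_cat l)" by (rule full_sub_total[OF l])
  show "Mor (total_cat l) \<subseteq>
      comp_closure (total_cat l) (\<Union>k\<in>{1, 2}. snd (incl D X) ` Mor (part_cat k l))"
    using assms(3) unfolding generated_def .
  show "is_functor (total_cat l) (total_cat (Suc l)) Q"
    using assms(2) unfolding glues_retracts_Suc by blast
  fix k :: nat assume k: "k \<in> {1, 2}"
  hence k': "k \<le> 2" by auto
  show "category (part_cat k l)" "full_sub (part_cat k (Suc l)) (part_cat k l)"
    "is_functor (part_cat k l) (total_cat l) (incl D X)"
    "is_functor (part_cat k l) (part_cat k (Suc l)) (P k (Suc l))"
    by (rule category_part[OF k' l'] full_sub_part[OF k' l] functor_part_total[OF k l']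
        retract_functor[OF retract_P[OF k' l]])+
  show "fun_eq_on (part_cat k l) (Q \<circ>\<^sub>F incl D X) (incl D X \<circ>\<^sub>F P k (Suc l))"
    using assms(2) k unfolding glues_retracts_Suc by blast
qed auto

lemma units_agree:
  assumes l: "l < n" and k: "k \<in> {1, 2}" "k' \<in> {1, 2}" and x: "x \<in> XX k l" "x \<in> XX k' l"
  shows "snd (incl D X) (u k (Suc l) x) = snd (incl D X) (u k' (Suc l) x)"
proof (cases "k = k'")
  case False
  hence x0: "x \<in> XX 0 l" using k x l XX_Int[of l] by auto
  hence "u 0 (Suc l) x \<in> Mor (part_cat 0 l)"
    using retract_unit_mor[OF retract_P[of 0 l]] l by simp
  hence "snd (incl D X) (u k (Suc l) x) = snd (incl D X) (u 0 (Suc l) x)" if "k \<in> {1, 2}" for k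
    using fun_eq_on_mor[OF fun_eq_on_incl_incl[of "XX 0 0" "XX k 0" X D "XX 0 l"]]
      u_incl[OF that l x0] that XX_Int[of 0] XX_0_subset_X[of k] by fastforce
  thus ?thesis using k by simp
qed simp

lemma glues_retracts_retract:
  assumes l: "l < n" and Q: "glues_retracts (Suc l) Q" and gen: "generated l"
  shows "\<exists>v. retract (fut (Suc l)) (total_cat l) (total_cat (Suc l)) Q v"
proof -
  interpret retract_cocone "{1, 2}" "\<lambda>k. part_cat k l" "\<lambda>k. part_cat k (Suc l)"
    "total_cat l" "total_cat (Suc l)" "\<lambda>k. incl D X" "\<lambda>k. P k (Suc l)" Q
    by (rule retract_cocone_level[OF assms])
  show ?thesis
  proof (rule retract_glued)
    show "retract (fut (Suc l)) (part_cat k l) (part_cat k (Suc l)) (P k (Suc l)) (u k (Suc l))"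
      if "k \<in> {1, 2}" for k
      using that l by (intro retract_P) auto
  qed (rule units_agree[OF l]; simp)
qed

lemma cat_retraction_total:
  assumes "l < n" "glues_retracts (Suc l) Q" "generated l"
  shows "cat_retraction (total_cat l) (total_cat (Suc l)) Q"
proof -
  obtain v where "retract (fut (Suc l)) (total_cat l) (total_cat (Suc l)) Q v"
    using glues_retracts_retract[OF assms] by blast
  thus ?thesis
    using assms(1) by (intro retract_cat_retraction[OF category_total full_sub_total]) auto
qed

lemma generated_Suc:
  assumes "l < n" "glues_retracts (Suc l) Q" "generated l"
  shows "generated (Suc l)"
  unfolding generated_def
  using retract_cocone_level[OF assms] cat_retraction_total[OF assms]
  by (rule retract_cocone.generated_B)

lemma level_pushout_Suc:
  assumes l: "l < n" and Q: "glues_retracts (Suc l) Q" and gen: "generated l"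
    and po: "level_pushout TYPE(('oe, 'me) cat) l"
  shows "level_pushout TYPE(('oe, 'me) cat) (Suc l)"
  by (rule pushout_retract[OF po cat_retraction_P cat_retraction_P cat_retraction_P
        cat_retraction_total[OF l Q gen] P_incl P_incl])
    (use l Q in \<open>auto simp: glues_retracts_Suc\<close>)

lemma generated_0: "generated 0"
proof -
  interpret d_cover X D "{1, 2}" "\<lambda>k. XX k 0"
    using d_space_X XX_subset_X cover by unfold_locales auto
  show ?thesis using fc_generated_by_pieces by (simp add: generated_def XX_Un_0[unfolded One_nat_def])
qed

lemma level_pushout_0: "level_pushout TYPE(('oe, 'me) cat) 0"
  using van_Kampen[OF d_space_X XX_subset_X cover] XX_Int[of 0]
  by (simp add: XX_Un_0[unfolded One_nat_def])

text \<open>The functor that glues the retracts has a category of dipath classes as its target, so the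
  induction needs the universal property at that type whatever the type of the final test category.\<close>
lemma level_pushout_generated:
  "l \<le> n \<Longrightarrow> level_pushout TYPE(('a, 'a dmor) cat) l \<and> generated l"
proof (induction l)
  case 0
  show ?case using level_pushout_0 generated_0 by blast
next
  case (Suc l)
  hence l: "l < n" and po: "level_pushout TYPE(('a, 'a dmor) cat) l" and gen: "generated l" by auto
  obtain Q where "glues_retracts (Suc l) Q" using glues_retracts_exists[OF l po] .
  thus ?case using level_pushout_Suc[OF l _ gen po] generated_Suc[OF l _ gen] by blast
qed

theorem glues_retracts_ex_unique:
  assumes "l \<in> {1..n}"
  shows "\<exists>Q. glues_retracts l Q \<and> (\<forall>Q'. glues_retracts l Q' \<longrightarrow> fun_eq_on (total_cat (l - 1)) Q Q') \<and>
    (\<exists>v. retract (fut l) (total_cat (l - 1)) (total_cat l) Q v)"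
proof -
  obtain m where l: "l = Suc m" "m < n" using assms by (cases l) auto
  hence po: "level_pushout TYPE(('a, 'a dmor) cat) m" and gen: "generated m"
    using level_pushout_generated[of m] by auto
  obtain Q where Q: "glues_retracts (Suc m) Q"
    "\<forall>Q'. glues_retracts (Suc m) Q' \<longrightarrow> fun_eq_on (total_cat m) Q Q'"
    using glues_retracts_exists[OF l(2) po] .
  thus ?thesis
    unfolding l(1) diff_Suc_1 using glues_retracts_retract[OF l(2) Q(1) gen] by blast
qed

theorem level_pushout: "l \<le> n \<Longrightarrow> level_pushout TYPE(('oe, 'me) cat) l"
proof (induction l)
  case 0
  show ?case by (rule level_pushout_0)
next
  case (Suc l)
  hence l: "l < n" by simp
  hence "\<exists>Q. glues_retracts (Suc l) Q" using glues_retracts_ex_unique[of "Suc l"] by auto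
  then obtain Q where "glues_retracts (Suc l) Q" by blast
  thus ?case using level_pushout_Suc[OF l] level_pushout_generated[of l] Suc by simp
qed

end

theorem theorem4p8:
  fixes X :: "'a::topological_space set" and D :: "(real \<Rightarrow> 'a) set"
    and X1 X2 :: "'a set" and n :: nat
    and XX :: "nat \<Rightarrow> nat \<Rightarrow> 'a set"
    and P :: "nat \<Rightarrow> nat \<Rightarrow> ('a, 'a dmor, 'a, 'a dmor) ftr"
    and u :: "nat \<Rightarrow> nat \<Rightarrow> 'a \<Rightarrow> 'a dmor"
    and fut :: "nat \<Rightarrow> bool"
  assumes dsp: "d_space X D"
    and sub: "X1 \<subseteq> X" "X2 \<subseteq> X"
    and cover: "X = (top_of_set X interior_of X1) \<union> (top_of_set X interior_of X2)"
    and concat: "\<forall>p\<in>D. \<exists>m (t :: nat \<Rightarrow> real). t 0 = 0 \<and> t m = 1 \<and> (\<forall>i<m. t i < t (Suc i)) \<and>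
                   (\<forall>i<m. p ` {t i..t (Suc i)} \<subseteq> X1 \<or> p ` {t i..t (Suc i)} \<subseteq> X2)"
    and base: "XX 0 0 = X1 \<inter> X2" "XX 1 0 = X1" "XX 2 0 = X2"
    and decr: "\<forall>k\<le>2. \<forall>l\<in>{1..n}. XX k l \<subseteq> XX k (l - 1)"
    and inter: "\<forall>l\<in>{1..n}. XX 0 l = XX 1 l \<inter> XX 2 l"
    and cover_l: "\<forall>l\<in>{1..n}. XX 1 l \<union> XX 2 l =
                     (top_of_set (XX 1 l \<union> XX 2 l) interior_of XX 1 l) \<union>
                     (top_of_set (XX 1 l \<union> XX 2 l) interior_of XX 2 l)"
    and retr: "\<forall>k\<le>2. \<forall>l\<in>{1..n}.
                 retract (fut l) (fc D (XX k 0) (XX k (l - 1))) (fc D (XX k 0) (XX k l)) (P k l) (u k l)"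
    and commute: "\<forall>k\<in>{1, 2}. \<forall>l\<in>{1..n}.
                 fun_eq_on (fc D (XX 0 0) (XX 0 (l - 1)))
                   (P k l \<circ>\<^sub>F incl D (XX k 0)) (incl D (XX k 0) \<circ>\<^sub>F P 0 l)"
    and unit_compat: "\<forall>k\<in>{1, 2}. \<forall>l\<in>{1..n}. \<forall>x\<in>XX 0 (l - 1).
                 snd (incl D (XX k 0)) (u 0 l x) = u k l x"
  shows "(\<forall>l\<le>n. is_pushout TYPE(('o, 'm) cat)
            (fc D (XX 0 0) (XX 0 l)) (fc D (XX 1 0) (XX 1 l)) (fc D (XX 2 0) (XX 2 l))
            (fc D X (XX 1 l \<union> XX 2 l))
            (incl D (XX 1 0)) (incl D (XX 2 0)) (incl D X) (incl D X)) \<and>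
         (\<forall>l\<in>{1..n}. \<exists>Q.
            is_functor (fc D X (XX 1 (l - 1) \<union> XX 2 (l - 1))) (fc D X (XX 1 l \<union> XX 2 l)) Q \<and>
            (\<forall>k\<in>{1, 2}. fun_eq_on (fc D (XX k 0) (XX k (l - 1)))
                            (Q \<circ>\<^sub>F incl D X) (incl D X \<circ>\<^sub>F P k l)) \<and>
            (\<forall>Q'. is_functor (fc D X (XX 1 (l - 1) \<union> XX 2 (l - 1))) (fc D X (XX 1 l \<union> XX 2 l)) Q' \<and>
                  (\<forall>k\<in>{1, 2}. fun_eq_on (fc D (XX k 0) (XX k (l - 1)))
                                  (Q' \<circ>\<^sub>F incl D X) (incl D X \<circ>\<^sub>F P k l))
                  \<longrightarrow> fun_eq_on (fc D X (XX 1 (l - 1) \<union> XX 2 (l - 1))) Q Q') \<and>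
            (\<exists>v. retract (fut l) (fc D X (XX 1 (l - 1) \<union> XX 2 (l - 1))) (fc D X (XX 1 l \<union> XX 2 l)) Q v))"
proof -
  interpret compatible_chains X D n XX P u fut
  proof
    show "XX 0 l = XX 1 l \<inter> XX 2 l" if "l \<le> n" for l using that base inter by (cases l) auto
    fix k l assume k: "k \<le> (2::nat)" and "l < n"
    hence l: "Suc l \<in> {1..n}" by simp
    show "XX k (Suc l) \<subseteq> XX k l" using decr[rule_format, OF k l] by simp
    show "retract (fut (Suc l)) (fc D (XX k 0) (XX k l)) (fc D (XX k 0) (XX k (Suc l)))
        (P k (Suc l)) (u k (Suc l))"
      using retr[rule_format, OF k l] by simp
  next
    fix k l assume k: "k \<in> {1::nat, 2}" and "l < n"
    hence l: "Suc l \<in> {1..n}" by simp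
    show "fun_eq_on (fc D (XX 0 0) (XX 0 l))
        (P k (Suc l) \<circ>\<^sub>F incl D (XX k 0)) (incl D (XX k 0) \<circ>\<^sub>F P 0 (Suc l))"
      using commute[rule_format, OF k l] by simp
    show "snd (incl D (XX k 0)) (u 0 (Suc l) x) = u k (Suc l) x" if "x \<in> XX 0 l" for x
      using unit_compat[rule_format, OF k l] that by simp
  qed (use dsp sub cover base in simp_all)
  show ?thesis
    using level_pushout glues_retracts_ex_unique unfolding glues_retracts_def conj_assoc by blast
qed

end
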